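(* For each $2 \leqslant s \leqslant t$, there exists a constant $C = C(s,t)$ such that the following holds for all sufficiently large $n, k \in \mathbb{N}$ with $k \leqslant n^{(s-1)/s(st-1)}/(\log n)^{1/(s-1)}$. There exists a collection $\mathcal{G}_{s,t}(k)$ of at most $\exp\big( C k^{-(s-1)} n^{2-1/s} \log k \big)$ graphs on vertex set $[n]$ such that $e(G) \leqslant k n^{2-1/s}$ for every $G \in \mathcal{G}_{s,t}(k)$, and every $K_{s,t}$-free graph on vertex set $[n]$ is a subgraph of some $G \in \mathcal{G}_{s,t}(k)$.
   Context: $K_{s,t}$ is the complete bipartite graph with part sizes $s$ and $t$; $e(G)$ is the number of edges of $G$. *)

theory Defs
  imports Complex_Main
begin

text \<open>A simple graph is a pair of a vertex set and a set of edges, where edges are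
  two-element sets of vertices. Well-formedness is the predicate \<open>simple_graph\<close>.\<close>

type_synonym 'a graph = "'a set \<times> 'a set set"

abbreviation verts :: "'a graph \<Rightarrow> 'a set" where
  "verts G \<equiv> fst G"

abbreviation edges :: "'a graph \<Rightarrow> 'a set set" where
  "edges G \<equiv> snd G"

definition simple_graph :: "'a graph \<Rightarrow> bool" where
  "simple_graph G \<longleftrightarrow> finite (verts G) \<and> (\<forall>e\<in>edges G. e \<subseteq> verts G \<and> card e = 2)"

definition graphs_on :: "nat \<Rightarrow> nat graph set" where
  "graphs_on n = {G. simple_graph G \<and> verts G = {1..n}}"

definition num_edges :: "'a graph \<Rightarrow> nat" where
  "num_edges G = card (edges G)"

definition subgraph :: "'a graph \<Rightarrow> 'a graph \<Rightarrow> bool" where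
  "subgraph H G \<longleftrightarrow> verts H \<subseteq> verts G \<and> edges H \<subseteq> edges G"

definition complete_bipartite :: "nat \<Rightarrow> nat \<Rightarrow> (nat + nat) graph" where
  "complete_bipartite s t =
     ({..<s} <+> {..<t}, {{Inl i, Inr j} | i j. i < s \<and> j < t})"

text \<open>Copies are subgraphs that need not be induced.\<close>

definition contains_copy :: "'a graph \<Rightarrow> 'b graph \<Rightarrow> bool" where
  "contains_copy G H \<longleftrightarrow>
     (\<exists>f. inj_on f (verts H) \<and> f ` verts H \<subseteq> verts G \<and> (\<forall>e\<in>edges H. f ` e \<in> edges G))"

definition K_free :: "nat \<Rightarrow> nat \<Rightarrow> 'a graph \<Rightarrow> bool" where
  "K_free s t G \<longleftrightarrow> \<not> contains_copy G (complete_bipartite s t)"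

end

theory Submission
  imports Defs
begin

text \<open>
  Both the container lemma and the supersaturation are phrased with weights on hyperedges instead of
  hypergraphs: what a container step needs is a probability distribution on the copies of
  $K_{s,t}$ in a graph $G$ with $m$ edges for which any $j$ edges lie in the random copy with
  probability $O(\tau^{j-1}/m)$.

  Such a distribution exists with $\tau = 1/(x \lambda^{s-1})$, where $m = x n^{2-1/s}$ and
  $\lambda$ is the minimum of $x$ and $\kappa = n^{(s-1)/s(st-1)}$. In a bipartite graph, cut every
  neighbourhood into disjoint blocks of the same size $D \approx x n^{1-1/s}$, pick an $s$-set $S$ with
  probability proportional to the number of blocks that contain it, discarding those contained in
  fewer than about $x^s$ blocks, and then pick $t$ of these blocks uniformly. Fixing $a$ vertices on
  one side and $b$ on the other costs a factor $D^{-(a-1)} x^{-s(b-1)}$ beyond $1/m$, and this is at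
  most $\tau^{ab-1}$ up to constants by the choice of $\kappa$.

  A container step shrinks a graph by a constant factor at the price of a factor
  $\exp(O(n^{2-1/s} \lambda^{-(s-1)} \log x))$ in the number of graphs. Starting from the complete graph,
  the steps with $x \le \kappa$ form a geometric series dominated by $x = k$. The $O(\log n)$ steps with
  $x > \kappa$ cost $\kappa^{-(s-1)} \log n$ each, which the logarithm in the bound on $k$ absorbs.
\<close>

subsection \<open>Containers for weighted hypergraphs\<close>

text \<open>Degrees in an arbitrary graph can be very uneven, whereas the random copy must not
  favour any set of edges. If \<open>S\<close> were drawn from whole neighbourhoods, a vertex of
  huge degree would offer far too many \<open>S\<close> per edge. Blocks of a common size
  \<open>D\<close> remove this obstacle: a vertex \<open>y\<close> and one point of a block of
  \<open>y\<close> determine the block, so \<open>y\<close> and \<open>a\<close> such points leave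
  at most \<open>D ^ (s - a)\<close> choices of \<open>S\<close>, whatever the degree of
  \<open>y\<close>. Drawing \<open>S\<close> in proportion to the number of its blocks makes the
  incidence of \<open>S\<close> with a member of \<open>T\<close> uniform, so that the first vertex
  of \<open>T\<close> costs the same for every \<open>S\<close>; the lower threshold on that number
  controls each further vertex of \<open>T\<close>.

  Weights instead of hypergraphs also let links of different vertices be added up with a real
  factor, and let the law of the random copy be used as it is.\<close>

definition codeg :: "'a set \<Rightarrow> ('a set \<Rightarrow> real) \<Rightarrow> 'a set \<Rightarrow> real" where
  "codeg V \<mu> \<sigma> = sum \<mu> {D \<in> Pow V. \<sigma> \<subseteq> D}"

text \<open>This is the usual codegree condition for containers, with the total weight 1 in the role
  of the number of hyperedges. The lower bound on the total weight is stated separately, so that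
  partial sums of links, which start at zero, satisfy the predicate as well.\<close>

definition spread :: "'a set \<Rightarrow> nat \<Rightarrow> real \<Rightarrow> real \<Rightarrow> ('a set \<Rightarrow> real) \<Rightarrow> bool" where
  "spread V r K \<tau> \<mu> \<longleftrightarrow>
     (\<forall>D. 0 \<le> \<mu> D) \<and> (\<forall>D. \<mu> D \<noteq> 0 \<longrightarrow> D \<subseteq> V \<and> card D = r) \<and>
     (\<forall>\<sigma>. \<sigma> \<noteq> {} \<longrightarrow> \<sigma> \<subseteq> V \<longrightarrow> codeg V \<mu> \<sigma> \<le> K * \<tau> ^ (card \<sigma> - 1) / card V)"

definition indep_set :: "('a set \<Rightarrow> real) \<Rightarrow> 'a set \<Rightarrow> bool" where
  "indep_set \<mu> I \<longleftrightarrow> (\<forall>D \<subseteq> I. \<mu> D = 0)"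

lemma codeg_mono:
  assumes "\<And>D. D \<subseteq> V \<Longrightarrow> \<sigma> \<subseteq> D \<Longrightarrow> \<mu> D \<le> \<mu>' D"
  shows "codeg V \<mu> \<sigma> \<le> codeg V \<mu>' \<sigma>"
  unfolding codeg_def using assms by (intro sum_mono) auto

lemma codeg_nonneg:
  assumes "\<And>D. 0 \<le> \<mu> D"
  shows "0 \<le> codeg V \<mu> \<sigma>"
  unfolding codeg_def using assms by (intro sum_nonneg) auto

lemma sum_codeg:
  assumes "finite V" "\<Sigma> \<subseteq> Pow V"
  shows "(\<Sum>\<sigma>\<in>\<Sigma>. codeg V \<mu> \<sigma>) = (\<Sum>D\<in>Pow V. real (card {\<sigma> \<in> \<Sigma>. \<sigma> \<subseteq> D}) * \<mu> D)"
proof -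
  have fin: "finite \<Sigma>" using assms finite_subset by auto
  have "(\<Sum>\<sigma>\<in>\<Sigma>. codeg V \<mu> \<sigma>) = (\<Sum>\<sigma>\<in>\<Sigma>. \<Sum>D\<in>Pow V. if \<sigma> \<subseteq> D then \<mu> D else 0)"
    using assms(1) unfolding codeg_def by (simp add: sum.If_cases Int_def)
  also have "\<dots> = (\<Sum>D\<in>Pow V. \<Sum>\<sigma>\<in>\<Sigma>. if \<sigma> \<subseteq> D then \<mu> D else 0)"
    by (rule sum.swap)
  also have "\<dots> = (\<Sum>D\<in>Pow V. real (card {\<sigma> \<in> \<Sigma>. \<sigma> \<subseteq> D}) * \<mu> D)"
    using fin by (simp add: sum.If_cases Int_def)
  finally show ?thesis .
qed

text \<open>The link of \<open>v\<close> is supported on sets that avoid \<open>v\<close>, hence the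
  zero for \<open>v \<in> \<sigma>\<close>. Otherwise adding \<open>v\<close> is a bijection onto
  the sets above \<open>insert v \<sigma>\<close>.\<close>

lemma codeg_link:
  assumes "finite V" "v \<in> V"
  shows "codeg V (\<lambda>E. if v \<in> E then 0 else \<mu> (insert v E)) \<sigma>
       = (if v \<in> \<sigma> then 0 else codeg V \<mu> (insert v \<sigma>))"
proof (cases "v \<in> \<sigma>")
  case True
  then show ?thesis unfolding codeg_def by (auto intro!: sum.neutral)
next
  case False
  have "codeg V (\<lambda>E. if v \<in> E then 0 else \<mu> (insert v E)) \<sigma>
      = (\<Sum>E\<in>{E \<in> Pow V. \<sigma> \<subseteq> E \<and> v \<notin> E}. \<mu> (insert v E))"
    unfolding codeg_def using assms(1) by (intro sum.mono_neutral_cong_right) auto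
  also have "\<dots> = sum \<mu> {D \<in> Pow V. insert v \<sigma> \<subseteq> D}"
    by (rule sum.reindex_bij_witness[where i = "\<lambda>D. D - {v}" and j = "insert v"])
       (use assms False in \<open>auto simp: insert_absorb\<close>)
  finally show ?thesis using False unfolding codeg_def by simp
qed

text \<open>Union bound over the members of \<open>\<Sigma>\<close>.\<close>

lemma mass_le_sum_codeg:
  assumes "finite V" "\<And>D. 0 \<le> \<mu> D" "\<Sigma> \<subseteq> Pow V"
  shows "(\<Sum>D\<in>{D \<in> Pow V. \<exists>\<sigma>\<in>\<Sigma>. \<sigma> \<subseteq> D}. \<mu> D) \<le> (\<Sum>\<sigma>\<in>\<Sigma>. codeg V \<mu> \<sigma>)"
proof -
  have fin: "finite \<Sigma>" using assms(1,3) finite_subset by (metis finite_Pow_iff)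
  have "(\<Sum>D\<in>{D \<in> Pow V. \<exists>\<sigma>\<in>\<Sigma>. \<sigma> \<subseteq> D}. \<mu> D)
      \<le> (\<Sum>D\<in>{D \<in> Pow V. \<exists>\<sigma>\<in>\<Sigma>. \<sigma> \<subseteq> D}. real (card {\<sigma> \<in> \<Sigma>. \<sigma> \<subseteq> D}) * \<mu> D)"
  proof (rule sum_mono)
    fix D assume "D \<in> {D \<in> Pow V. \<exists>\<sigma>\<in>\<Sigma>. \<sigma> \<subseteq> D}"
    then have "{\<sigma> \<in> \<Sigma>. \<sigma> \<subseteq> D} \<noteq> {}" by auto
    then have "1 \<le> card {\<sigma> \<in> \<Sigma>. \<sigma> \<subseteq> D}"
      using fin by (simp add: Suc_le_eq card_gt_0_iff)
    then show "\<mu> D \<le> real (card {\<sigma> \<in> \<Sigma>. \<sigma> \<subseteq> D}) * \<mu> D"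
      using mult_right_mono[of 1 "real (card {\<sigma> \<in> \<Sigma>. \<sigma> \<subseteq> D})" "\<mu> D"] assms(2) by simp
  qed
  also have "\<dots> \<le> (\<Sum>D\<in>Pow V. real (card {\<sigma> \<in> \<Sigma>. \<sigma> \<subseteq> D}) * \<mu> D)"
    using assms by (intro sum_mono2) auto
  also have "\<dots> = (\<Sum>\<sigma>\<in>\<Sigma>. codeg V \<mu> \<sigma>)"
    using sum_codeg[OF assms(1,3)] by simp
  finally show ?thesis .
qed

text \<open>The sets in \<open>sat\<close> have exhausted their codegree in the link weight \<open>\<nu>\<close>. There are so few of them
  that deleting all hyperedges above them, and all those that leave \<open>U\<close>, keeps half of the weight.\<close>

lemma exists_vertex_large_degree:
  fixes \<mu> \<nu> :: "'a set \<Rightarrow> real" and V U :: "'a set" and B K \<tau> c :: real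
  defines "m \<equiv> real (card V)"
  defines "sat \<equiv> {\<sigma> \<in> Pow V. \<sigma> \<noteq> {} \<and> B * K * \<tau> ^ (card \<sigma> - 1) / m \<le> codeg V \<nu> \<sigma>}"
  defines "\<mu>A \<equiv> \<lambda>D. if D \<subseteq> U \<and> \<not> (\<exists>\<sigma>\<in>sat. \<sigma> \<subseteq> D) then \<mu> D else 0"
  assumes V: "finite V" "V \<noteq> {}" and \<mu>: "spread V (Suc q) K \<tau> \<mu>" "1 \<le> codeg V \<mu> {}"
    and \<nu>: "\<And>D. 0 \<le> \<nu> D" "\<And>D. \<nu> D \<noteq> 0 \<Longrightarrow> D \<subseteq> V \<and> card D = q" "codeg V \<nu> {} \<le> 1"
    and B: "4 * 2 ^ q \<le> B" and U: "U \<subseteq> V" "real (card (V - U)) * K \<le> m / 4"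
  shows "\<exists>v\<in>U. 1 / (2 * m) \<le> codeg V \<mu>A {v}"
proof -
  have \<mu>0: "\<And>D. 0 \<le> \<mu> D" and \<mu>supp: "\<And>D. \<mu> D \<noteq> 0 \<Longrightarrow> D \<subseteq> V \<and> card D = Suc q"
    and \<mu>deg: "\<And>\<sigma>. \<sigma> \<noteq> {} \<Longrightarrow> \<sigma> \<subseteq> V \<Longrightarrow> codeg V \<mu> \<sigma> \<le> K * \<tau> ^ (card \<sigma> - 1) / m"
    using \<mu>(1) unfolding spread_def m_def by auto
  have m: "0 < m" using V unfolding m_def by (simp add: card_gt_0_iff)
  have B0: "0 < B" using B by (smt (verit) zero_less_power)
  have fin: "finite U" using U(1) V(1) finite_subset by auto
  have "(\<Sum>D\<in>{D \<in> Pow V. \<exists>\<sigma>\<in>sat. \<sigma> \<subseteq> D}. \<mu> D) \<le> (\<Sum>\<sigma>\<in>sat. codeg V \<mu> \<sigma>)"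
    using V(1) \<mu>0 by (intro mass_le_sum_codeg) (auto simp: sat_def)
  \<comment> \<open>A saturated \<open>\<sigma>\<close> has in \<open>\<nu>\<close> at least
    \<open>B\<close> times the codegree that \<open>\<mu>\<close> can give it. Summed over all
    subsets of \<open>V\<close>, a hyperedge of \<open>\<nu>\<close> counts once for each of its
    \<open>2 ^ q\<close> subsets, and \<open>B\<close> is at least four times that number.\<close>
  also have "\<dots> \<le> (\<Sum>\<sigma>\<in>sat. codeg V \<nu> \<sigma> / B)"
  proof (rule sum_mono)
    fix \<sigma> assume "\<sigma> \<in> sat"
    then have a: "\<sigma> \<noteq> {}" "\<sigma> \<subseteq> V" "B * (K * \<tau> ^ (card \<sigma> - 1) / m) \<le> codeg V \<nu> \<sigma>"
      unfolding sat_def by (auto simp: mult.assoc)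
    then have "K * \<tau> ^ (card \<sigma> - 1) / m \<le> codeg V \<nu> \<sigma> / B"
      using B0 by (simp add: field_simps)
    then show "codeg V \<mu> \<sigma> \<le> codeg V \<nu> \<sigma> / B" using \<mu>deg[OF a(1,2)] by linarith
  qed
  also have "\<dots> \<le> (\<Sum>\<sigma>\<in>Pow V. codeg V \<nu> \<sigma> / B)"
    using V(1) B0 by (intro sum_mono2) (auto simp: sat_def intro!: divide_nonneg_pos codeg_nonneg \<nu>(1))
  also have "\<dots> = (\<Sum>D\<in>Pow V. real (card {\<sigma> \<in> Pow V. \<sigma> \<subseteq> D}) * \<nu> D) / B"
    using sum_codeg[OF V(1) order_refl, of \<nu>] by (simp add: sum_divide_distrib[symmetric])
  also have "(\<Sum>D\<in>Pow V. real (card {\<sigma> \<in> Pow V. \<sigma> \<subseteq> D}) * \<nu> D) = (\<Sum>D\<in>Pow V. 2 ^ q * \<nu> D)"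
  proof (rule sum.cong[OF refl])
    fix D assume D: "D \<in> Pow V"
    then have "{\<sigma> \<in> Pow V. \<sigma> \<subseteq> D} = Pow D" by auto
    moreover have "finite D" using D V(1) finite_subset by auto
    ultimately show "real (card {\<sigma> \<in> Pow V. \<sigma> \<subseteq> D}) * \<nu> D = 2 ^ q * \<nu> D"
      using \<nu>(2)[of D] by (cases "\<nu> D = 0") (auto simp: card_Pow)
  qed
  also have "\<dots> = 2 ^ q * codeg V \<nu> {}" by (simp add: codeg_def sum_distrib_left Pow_def)
  also have "\<dots> / B \<le> 1 / 4"
  proof -
    have "2 ^ q * codeg V \<nu> {} \<le> 2 ^ q * 1" using \<nu>(3) by (intro mult_left_mono) auto
    then have "4 * (2 ^ q * codeg V \<nu> {}) \<le> B" using B by linarith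
    then show ?thesis using B0 by (simp add: field_simps)
  qed
  finally have lost1: "(\<Sum>D\<in>{D \<in> Pow V. \<exists>\<sigma>\<in>sat. \<sigma> \<subseteq> D}. \<mu> D) \<le> 1 / 4" .
  have "(\<Sum>D\<in>{D \<in> Pow V. \<exists>\<sigma>\<in>(\<lambda>v. {v}) ` (V - U). \<sigma> \<subseteq> D}. \<mu> D)
      \<le> (\<Sum>\<sigma>\<in>(\<lambda>v. {v}) ` (V - U). codeg V \<mu> \<sigma>)"
    using V(1) \<mu>0 by (intro mass_le_sum_codeg) auto
  also have "\<dots> = (\<Sum>v\<in>V - U. codeg V \<mu> {v})" by (subst sum.reindex) auto
  also have "\<dots> \<le> (\<Sum>v\<in>V - U. K / m)"
    by (intro sum_mono) (use \<mu>deg[of "{_}"] in fastforce)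
  also have "\<dots> \<le> 1 / 4" using U(2) m by (simp add: field_simps)
  finally have lost2: "(\<Sum>D\<in>{D \<in> Pow V. \<exists>\<sigma>\<in>(\<lambda>v. {v}) ` (V - U). \<sigma> \<subseteq> D}. \<mu> D) \<le> 1 / 4" .
  have "1 \<le> (\<Sum>D\<in>Pow V. \<mu> D)" using \<mu>(2) by (simp add: codeg_def Pow_def)
  also have "\<dots> \<le> (\<Sum>D\<in>Pow V. \<mu>A D + (if \<exists>\<sigma>\<in>sat. \<sigma> \<subseteq> D then \<mu> D else 0)
       + (if \<exists>\<sigma>\<in>(\<lambda>v. {v}) ` (V - U). \<sigma> \<subseteq> D then \<mu> D else 0))"
    by (intro sum_mono) (use \<mu>0 in \<open>auto simp: \<mu>A_def\<close>)
  also have "\<dots> = (\<Sum>D\<in>Pow V. \<mu>A D) + (\<Sum>D\<in>{D \<in> Pow V. \<exists>\<sigma>\<in>sat. \<sigma> \<subseteq> D}. \<mu> D)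
       + (\<Sum>D\<in>{D \<in> Pow V. \<exists>\<sigma>\<in>(\<lambda>v. {v}) ` (V - U). \<sigma> \<subseteq> D}. \<mu> D)"
    using V(1) by (simp only: sum.distrib) (simp add: sum.If_cases Int_def)
  finally have mass: "1 / 2 \<le> (\<Sum>D\<in>Pow V. \<mu>A D)" using lost1 lost2 by linarith
  show ?thesis
  proof (rule ccontr)
    assume "\<not> ?thesis"
    then have small: "\<And>v. v \<in> U \<Longrightarrow> codeg V \<mu>A {v} < 1 / (2 * m)" by force
    have ne: "U \<noteq> {}"
    proof
      assume "U = {}"
      moreover have "\<mu> {} = 0" using \<mu>supp[of "{}"] by auto
      ultimately have "\<mu>A D = 0" for D by (auto simp: \<mu>A_def)
      then show False using mass by simp
    qed
    have "(\<Sum>D\<in>Pow V. \<mu>A D) \<le> (\<Sum>D\<in>{D \<in> Pow V. \<exists>\<sigma>\<in>(\<lambda>v. {v}) ` U. \<sigma> \<subseteq> D}. \<mu>A D)"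
    proof -
      have "D \<inter> U \<noteq> {}" if "\<mu>A D \<noteq> 0" for D
      proof -
        have "D \<subseteq> U" "\<mu> D \<noteq> 0" using that by (auto simp: \<mu>A_def split: if_splits)
        then show ?thesis using \<mu>supp[of D] by (cases "D = {}") auto
      qed
      then have "(\<Sum>D\<in>Pow V. \<mu>A D) = (\<Sum>D\<in>{D \<in> Pow V. \<exists>\<sigma>\<in>(\<lambda>v. {v}) ` U. \<sigma> \<subseteq> D}. \<mu>A D)"
        using V(1) by (intro sum.mono_neutral_right) auto
      then show ?thesis by simp
    qed
    also have "\<dots> \<le> (\<Sum>\<sigma>\<in>(\<lambda>v. {v}) ` U. codeg V \<mu>A \<sigma>)"
      using V(1) U(1) \<mu>0 by (intro mass_le_sum_codeg) (auto simp: \<mu>A_def)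
    also have "\<dots> = (\<Sum>v\<in>U. codeg V \<mu>A {v})" by (subst sum.reindex) auto
    also have "\<dots> < (\<Sum>v\<in>U. 1 / (2 * m))"
      using fin ne small by (intro sum_strict_mono) auto
    also have "\<dots> = real (card U) / (2 * m)" by simp
    also have "\<dots> \<le> 1 / 2"
      using card_mono[OF V(1) U(1)] m unfolding m_def by (simp add: field_simps)
    finally show False using mass by linarith
  qed
qed

text \<open>
  A state of a decision procedure that queries vertices of an unknown independent set \<open>I\<close>: the vertices
  in \<open>U\<close> have not been queried, those in \<open>X\<close> are known to lie outside \<open>I\<close>, \<open>\<nu>\<close> collects the links of
  the vertices known to lie in \<open>I\<close>, and \<open>y\<close> bounds the number of positive answers still to come.
  Counting the leaves of the decision tree by \<open>(1 / \<tau>) ^ y * (1 + \<tau>) ^ card U\<close> makes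
  fingerprints unnecessary.
\<close>

lemma container_step_inner:
  fixes \<mu> :: "'a set \<Rightarrow> real" and V :: "'a set" and B K \<tau> N c :: real
  defines "m \<equiv> real (card V)"
  assumes V: "finite V" "V \<noteq> {}" and \<mu>: "spread V (Suc q) K \<tau> \<mu>" "1 \<le> codeg V \<mu> {}"
    and \<tau>: "0 < \<tau>" "\<tau> \<le> 1" and K: "1 \<le> K" and B: "4 * 2 ^ q + 16 * K \<le> B"
    and N: "1 \<le> N" and c: "0 < c" "c * K \<le> 1 / 8"
    and link: "\<And>\<nu>. spread V q (2 * B * K) \<tau> \<nu> \<Longrightarrow> 1 \<le> codeg V \<nu> {} \<Longrightarrow>
      \<exists>\<C>. \<C> \<subseteq> Pow V \<and> real (card \<C>) \<le> N \<and> (\<forall>C\<in>\<C>. real (card C) \<le> (1 - c) * m) \<and>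
        (\<forall>I\<subseteq>V. indep_set \<nu> I \<longrightarrow> (\<exists>C\<in>\<C>. I \<subseteq> C))"
    and UX: "U \<subseteq> V" "X \<subseteq> V" "U \<inter> X = {}"
    and \<nu>: "spread V q (2 * B * K) \<tau> \<nu>"
      "real (card (V - U - X)) * (B / (2 * m * \<tau>)) \<le> codeg V \<nu> {}"
      "1 \<le> codeg V \<nu> {} + real y * (B / (2 * m * \<tau>))"
  shows "\<exists>\<C>. \<C> \<subseteq> Pow V \<and> real (card \<C>) \<le> (1 / \<tau>) ^ y * (1 + \<tau>) ^ card U * N \<and>
        (\<forall>C\<in>\<C>. real (card C) \<le> (1 - c) * m) \<and>
        (\<forall>I\<subseteq>V. I \<inter> X = {} \<and> indep_set \<mu> I \<and> indep_set \<nu> I \<longrightarrow> (\<exists>C\<in>\<C>. I \<subseteq> C))"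
  using UX \<nu>
proof (induction "card U" arbitrary: U X \<nu> y rule: less_induct)
  case less
  note UX = less.prems(1-3) and \<nu> = less.prems(4-6)
  have \<mu>0: "\<And>D. 0 \<le> \<mu> D" and \<mu>supp: "\<And>D. \<mu> D \<noteq> 0 \<Longrightarrow> D \<subseteq> V \<and> card D = Suc q"
    and \<mu>deg: "\<And>\<sigma>. \<sigma> \<noteq> {} \<Longrightarrow> \<sigma> \<subseteq> V \<Longrightarrow> codeg V \<mu> \<sigma> \<le> K * \<tau> ^ (card \<sigma> - 1) / m"
    using \<mu>(1) unfolding spread_def m_def by auto
  have \<nu>0: "\<And>D. 0 \<le> \<nu> D" and \<nu>supp: "\<And>D. \<nu> D \<noteq> 0 \<Longrightarrow> D \<subseteq> V \<and> card D = q"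
    and \<nu>deg: "\<And>\<sigma>. \<sigma> \<noteq> {} \<Longrightarrow> \<sigma> \<subseteq> V \<Longrightarrow> codeg V \<nu> \<sigma> \<le> 2 * B * K * \<tau> ^ (card \<sigma> - 1) / m"
    using \<nu>(1) unfolding spread_def m_def by auto
  have m: "0 < m" using V unfolding m_def by (simp add: card_gt_0_iff)
  have "0 < (2::real) ^ q" by simp
  then have B1: "4 * 2 ^ q \<le> B" "16 * K \<le> B" "0 < B" using B K by linarith+
  have finU: "finite U" using UX(1) V(1) finite_subset by auto
  have Z1: "1 \<le> (1 / \<tau>) ^ y" "1 \<le> (1 + \<tau>) ^ card U"
    using \<tau> by (auto intro!: one_le_power)
  then have Z: "1 \<le> (1 / \<tau>) ^ y * (1 + \<tau>) ^ card U"
    using mult_mono[of 1 "(1 / \<tau>) ^ y" 1 "(1 + \<tau>) ^ card U"] by simp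
  then have ZN: "N \<le> (1 / \<tau>) ^ y * (1 + \<tau>) ^ card U * N"
    using N mult_right_mono[OF Z, of N] by simp
  show ?case
  \<comment> \<open>Many negative answers make \<open>V - X\<close> a container. Otherwise, link
    weight of total at least 1 hands over to uniformity \<open>q\<close>, and smaller link weight
    calls for another query.\<close>
  proof (cases "c * m \<le> card X")
    case True
    have "real (card (V - X)) = m - card X"
      using UX(2) V(1) unfolding m_def
      by (simp add: card_Diff_subset finite_subset card_mono of_nat_diff)
    then have "real (card (V - X)) \<le> (1 - c) * m"
      using True by (simp add: algebra_simps)
    moreover have "1 \<le> (1 / \<tau>) ^ y * (1 + \<tau>) ^ card U * N" using ZN N by linarith
    ultimately show ?thesis by (intro exI[of _ "{V - X}"]) auto
  next
    case X: False
    show ?thesis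
    proof (cases "1 \<le> codeg V \<nu> {}")
      case True
      show ?thesis using link[OF \<nu>(1) True] ZN by (meson order_trans)
    next
      case False
      then have small: "codeg V \<nu> {} \<le> 1" by simp
      obtain y' where y: "y = Suc y'"
        using \<nu>(3) False by (cases y) auto
      \<comment> \<open>\<open>V - U - X\<close> is the set of positive answers. Each accounts for
        \<open>B / (2 * m * \<tau>)\<close> of a total that is at most 1, so there are few of them;
        with the few negative answers they meet hyperedges of weight at most 1/4.\<close>
      have "real (card (V - U - X)) * (B / (2 * m * \<tau>)) \<le> 1" using \<nu>(2) small by linarith
      then have "real (card (V - U - X)) * B \<le> 2 * m * \<tau>"
        using m \<tau> by (simp add: field_simps)
      also have "\<dots> \<le> 2 * m" using m \<tau> by simp
      finally have "real (card (V - U - X)) * B \<le> 2 * m" .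
      moreover have "real (card (V - U - X)) * (16 * K) \<le> real (card (V - U - X)) * B"
        using B1(2) by (intro mult_left_mono) auto
      ultimately have T: "real (card (V - U - X)) * K \<le> m / 8" by linarith
      have "real (card X) * K \<le> c * m * K" using X K by (intro mult_right_mono) auto
      also have "\<dots> \<le> m / 8" using mult_right_mono[OF c(2), of m] m by (simp add: algebra_simps)
      finally have Xs: "real (card X) * K \<le> m / 8" .
      have "card (V - U) \<le> card (V - U - X) + card X"
        using V(1) UX by (metis card_Un_le Diff_partition Un_Diff_cancel2 Un_commute
            card_mono finite_Diff finite_Un finite_subset le_trans order_refl sup_ge1)
      then have "real (card (V - U)) * K \<le> (real (card (V - U - X)) + real (card X)) * K"
        using K by (intro mult_right_mono) (auto simp flip: of_nat_add)
      then have VU: "real (card (V - U)) * K \<le> m / 4"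
        using T Xs by (simp add: algebra_simps)
      define sat where
        "sat = {\<sigma> \<in> Pow V. \<sigma> \<noteq> {} \<and> B * K * \<tau> ^ (card \<sigma> - 1) / m \<le> codeg V \<nu> \<sigma>}"
      define \<mu>A where "\<mu>A = (\<lambda>D. if D \<subseteq> U \<and> \<not> (\<exists>\<sigma>\<in>sat. \<sigma> \<subseteq> D) then \<mu> D else 0)"
      obtain v where v: "v \<in> U" "1 / (2 * m) \<le> codeg V \<mu>A {v}"
        using exists_vertex_large_degree[OF V \<mu> \<nu>0 \<nu>supp small B1(1) UX(1) VU[unfolded m_def]]
        unfolding \<mu>A_def sat_def m_def by blast
      have \<mu>A0: "0 \<le> \<mu>A D" and \<mu>A_le: "\<mu>A D \<le> \<mu> D" for D
        using \<mu>0 by (auto simp: \<mu>A_def)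
      define \<eta> where "\<eta> = (\<lambda>E. if v \<in> E then 0 else \<mu>A (insert v E))"
      \<comment> \<open>The factor \<open>B / \<tau>\<close> turns the bound
        \<open>K * \<tau> ^ j / m\<close> on the codegree of a \<open>j\<close>-set in the link of
        \<open>v\<close> into \<open>B * K * \<tau> ^ (j - 1) / m\<close>. An unsaturated set is
        below this value, so the sum respects the constant \<open>2 * B * K\<close>.\<close>
      define \<nu>' where "\<nu>' = (\<lambda>E. \<nu> E + B / \<tau> * \<eta> E)"
      have \<eta>0: "0 \<le> \<eta> D" for D using \<mu>A0 by (auto simp: \<eta>_def)
      have vV: "v \<in> V" using v(1) UX(1) by auto
      have codeg_\<eta>: "codeg V \<eta> \<sigma> = (if v \<in> \<sigma> then 0 else codeg V \<mu>A (insert v \<sigma>))" for \<sigma>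
        unfolding \<eta>_def by (rule codeg_link[OF V(1) vV])
      have codeg\<nu>': "codeg V \<nu>' \<sigma> = codeg V \<nu> \<sigma> + B / \<tau> * codeg V \<eta> \<sigma>" for \<sigma>
        unfolding \<nu>'_def codeg_def by (simp add: sum.distrib sum_distrib_left)
      have B\<tau>: "0 < B / \<tau>" using B1 \<tau> by simp
      have spread\<nu>': "spread V q (2 * B * K) \<tau> \<nu>'"
        unfolding spread_def
      proof (intro conjI allI impI)
        fix D show "0 \<le> \<nu>' D" unfolding \<nu>'_def using \<nu>0 \<eta>0 B\<tau> by (intro add_nonneg_nonneg mult_nonneg_nonneg) auto
      next
        fix D assume "\<nu>' D \<noteq> 0"
        then consider "\<nu> D \<noteq> 0" | "\<eta> D \<noteq> 0" unfolding \<nu>'_def by fastforce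
        then have "D \<subseteq> V \<and> card D = q"
        proof cases
          case 2
          then have "v \<notin> D" "\<mu> (insert v D) \<noteq> 0"
            by (auto simp: \<eta>_def \<mu>A_def split: if_splits)
          then have "insert v D \<subseteq> V" "card (insert v D) = Suc q" "v \<notin> D"
            using \<mu>supp by auto
          moreover have "finite D" using calculation V(1) finite_subset by auto
          ultimately show ?thesis by auto
        qed (use \<nu>supp in auto)
        then show "D \<subseteq> V" "card D = q" by auto
      next
        fix \<sigma> assume \<sigma>: "\<sigma> \<noteq> {}" "\<sigma> \<subseteq> V"
        show "codeg V \<nu>' \<sigma> \<le> 2 * B * K * \<tau> ^ (card \<sigma> - 1) / real (card V)"
        proof (cases "\<sigma> \<in> sat \<or> v \<in> \<sigma>")
          case True
          \<comment> \<open>The link is taken in \<open>\<mu>A\<close>, which has no hyperedge above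
            a saturated set, so a saturated set gains nothing.\<close>
          have "codeg V \<eta> \<sigma> = 0"
          proof (cases "v \<in> \<sigma>")
            case False
            then have "\<mu>A D = 0" if "insert v \<sigma> \<subseteq> D" for D
              using that True unfolding \<mu>A_def by auto
            then show ?thesis unfolding codeg_\<eta> by (auto simp: codeg_def intro!: sum.neutral)
          qed (simp add: codeg_\<eta>)
          then show ?thesis using codeg\<nu>' \<nu>deg[OF \<sigma>] by (simp add: m_def)
        next
          case False
          have fs: "finite \<sigma>" using \<sigma> V(1) finite_subset by auto
          obtain j where j: "card \<sigma> = Suc j"
            using \<sigma>(1) fs by (metis card_0_eq not0_implies_Suc)
          have "codeg V \<nu> \<sigma> \<le> B * K * \<tau> ^ (card \<sigma> - 1) / m"
            using False \<sigma> unfolding sat_def by auto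
          moreover have "codeg V \<eta> \<sigma> \<le> codeg V \<mu> (insert v \<sigma>)"
            using False codeg_\<eta> \<mu>A_le by (simp add: codeg_mono)
          moreover have "codeg V \<mu> (insert v \<sigma>) \<le> K * \<tau> ^ Suc j / m"
            using \<mu>deg[of "insert v \<sigma>"] \<sigma> vV False fs j by auto
          then have "B / \<tau> * codeg V \<mu> (insert v \<sigma>) \<le> B / \<tau> * (K * \<tau> ^ Suc j / m)"
            using B\<tau> by (intro mult_left_mono) auto
          then have "B / \<tau> * codeg V \<mu> (insert v \<sigma>) \<le> B * K * \<tau> ^ (card \<sigma> - 1) / m"
            using \<tau> j by (simp add: field_simps)
          moreover have "B / \<tau> * codeg V \<eta> \<sigma> \<le> B / \<tau> * codeg V \<mu> (insert v \<sigma>)"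
            using calculation(2) B\<tau> by (intro mult_left_mono) auto
          ultimately show ?thesis unfolding codeg\<nu>' m_def by (simp add: add_divide_distrib[symmetric])
        qed
      qed
      have "B / \<tau> * (1 / (2 * m)) \<le> B / \<tau> * codeg V \<eta> {}"
        using v(2) B\<tau> by (intro mult_left_mono) (auto simp: codeg_\<eta>)
      then have grow: "codeg V \<nu> {} + B / (2 * m * \<tau>) \<le> codeg V \<nu>' {}"
        unfolding codeg\<nu>' by (simp add: mult.commute)
      have lt: "card (U - {v}) < card U" using v(1) finU by (meson card_Diff1_less)
      have cU: "card U = Suc (card (U - {v}))" using v(1) finU by (metis card_Suc_Diff1)
      let ?M = "(1 + \<tau>) ^ card (U - {v}) * N"
      have sets: "V - (U - {v}) - insert v X = V - U - X"
        "V - (U - {v}) - X = insert v (V - U - X)"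
        using v(1) vV UX by auto
      have "card (insert v (V - U - X)) = Suc (card (V - U - X))"
        using v(1) V(1) by auto
      then have c2: "real (card (V - (U - {v}) - X)) = real (card (V - U - X)) + 1"
        using sets(2) by simp
      \<comment> \<open>Negative answer: \<open>v\<close> joins \<open>X\<close> and
        \<open>y\<close> stays. For the positive answer, treated next, \<open>v\<close> joins
        neither set, \<open>\<nu>\<close> becomes \<open>\<nu>'\<close> and \<open>y\<close> drops
        by one.\<close>
      have "\<exists>\<C>1. \<C>1 \<subseteq> Pow V \<and> real (card \<C>1) \<le> (1 / \<tau>) ^ y * (1 + \<tau>) ^ card (U - {v}) * N \<and>
        (\<forall>C\<in>\<C>1. real (card C) \<le> (1 - c) * m) \<and>
        (\<forall>I\<subseteq>V. I \<inter> insert v X = {} \<and> indep_set \<mu> I \<and> indep_set \<nu> I \<longrightarrow> (\<exists>C\<in>\<C>1. I \<subseteq> C))"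
      proof (rule less.hyps[OF lt _ _ _ \<nu>(1) _ \<nu>(3)])
        show "real (card (V - (U - {v}) - insert v X)) * (B / (2 * m * \<tau>)) \<le> codeg V \<nu> {}"
          using \<nu>(2) unfolding sets .
      qed (use UX vV in auto)
      then obtain \<C>1 where \<C>1: "\<C>1 \<subseteq> Pow V" "real (card \<C>1) \<le> (1 / \<tau>) ^ y * ?M"
        "\<And>C. C \<in> \<C>1 \<Longrightarrow> real (card C) \<le> (1 - c) * m"
        "\<And>I. I \<subseteq> V \<Longrightarrow> I \<inter> insert v X = {} \<Longrightarrow> indep_set \<mu> I \<Longrightarrow> indep_set \<nu> I \<Longrightarrow> \<exists>C\<in>\<C>1. I \<subseteq> C"
        unfolding mult.assoc by metis
      have "\<exists>\<C>2. \<C>2 \<subseteq> Pow V \<and> real (card \<C>2) \<le> (1 / \<tau>) ^ y' * (1 + \<tau>) ^ card (U - {v}) * N \<and>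
        (\<forall>C\<in>\<C>2. real (card C) \<le> (1 - c) * m) \<and>
        (\<forall>I\<subseteq>V. I \<inter> X = {} \<and> indep_set \<mu> I \<and> indep_set \<nu>' I \<longrightarrow> (\<exists>C\<in>\<C>2. I \<subseteq> C))"
      proof (rule less.hyps[OF lt _ UX(2) _ spread\<nu>'])
        show "real (card (V - (U - {v}) - X)) * (B / (2 * m * \<tau>)) \<le> codeg V \<nu>' {}"
          using \<nu>(2) grow unfolding c2 distrib_right by linarith
        show "1 \<le> codeg V \<nu>' {} + real y' * (B / (2 * m * \<tau>))"
          using \<nu>(3) grow unfolding y of_nat_Suc distrib_right by linarith
      qed (use UX in auto)
      then obtain \<C>2 where \<C>2: "\<C>2 \<subseteq> Pow V" "real (card \<C>2) \<le> (1 / \<tau>) ^ y' * ?M"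
        "\<And>C. C \<in> \<C>2 \<Longrightarrow> real (card C) \<le> (1 - c) * m"
        "\<And>I. I \<subseteq> V \<Longrightarrow> I \<inter> X = {} \<Longrightarrow> indep_set \<mu> I \<Longrightarrow> indep_set \<nu>' I \<Longrightarrow> \<exists>C\<in>\<C>2. I \<subseteq> C"
        unfolding mult.assoc by metis
      show ?thesis
      proof (intro exI[of _ "\<C>1 \<union> \<C>2"] conjI allI impI ballI)
        have "real (card (\<C>1 \<union> \<C>2)) \<le> real (card \<C>1) + real (card \<C>2)"
          using card_Un_le[of \<C>1 \<C>2] by (simp flip: of_nat_add)
        also have "\<dots> \<le> (1 / \<tau>) ^ y * ?M + (1 / \<tau>) ^ y' * ?M" using \<C>1(2) \<C>2(2) by linarith
        \<comment> \<open>Losing one factor \<open>1 / \<tau>\<close> makes the positive branch a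
          fraction \<open>\<tau>\<close> of the negative one; the factor \<open>1 + \<tau>\<close>
          for the queried vertex pays for both.\<close>
        also have "\<dots> = (1 / \<tau>) ^ y * ((1 + \<tau>) * ?M)"
          using \<tau> unfolding y by (simp add: field_simps)
        also have "\<dots> = (1 / \<tau>) ^ y * (1 + \<tau>) ^ card U * N" unfolding cU by (simp add: algebra_simps)
        finally show "real (card (\<C>1 \<union> \<C>2)) \<le> (1 / \<tau>) ^ y * (1 + \<tau>) ^ card U * N" .
      next
        fix I assume I: "I \<subseteq> V" "I \<inter> X = {} \<and> indep_set \<mu> I \<and> indep_set \<nu> I"
        show "\<exists>C\<in>\<C>1 \<union> \<C>2. I \<subseteq> C"
        proof (cases "v \<in> I")
          case True
          have "indep_set \<nu>' I" unfolding indep_set_def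
          proof (intro allI impI)
            fix E assume E: "E \<subseteq> I"
            then have "insert v E \<subseteq> I" using True by auto
            then have "\<mu> (insert v E) = 0" using I unfolding indep_set_def by auto
            then have "\<eta> E = 0" unfolding \<eta>_def \<mu>A_def by auto
            then show "\<nu>' E = 0" using I E unfolding \<nu>'_def indep_set_def by auto
          qed
          then show ?thesis using \<C>2(4)[of I] I by auto
        next
          case False
          then show ?thesis using \<C>1(4)[of I] I by auto
        qed
      qed (use \<C>1 \<C>2 in auto)
    qed
  qed
qed

text \<open>In uniformity 1 every vertex of positive weight lies outside all independent sets. In
  higher uniformity the links of vertices known to lie in the set build up a weight of uniformity
  one less, with a larger \<open>K\<close>, for which the set is still independent. The assumption
  \<open>\<tau> \<le> exp (- 1)\<close> makes \<open>ln (1 / \<tau>)\<close> at least 1, and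
  \<open>1 \<le> card V * \<tau>\<close> pays for rounding up the number of positive
  answers.\<close>

theorem container_step:
  fixes K :: real
  assumes "1 \<le> r" "1 \<le> K"
  shows "\<exists>c Q :: real. 0 < c \<and> c < 1 \<and> 0 < Q \<and> (\<forall>(V :: 'a set) \<mu> (\<tau> :: real).
     finite V \<longrightarrow> V \<noteq> {} \<longrightarrow> 0 < \<tau> \<longrightarrow> \<tau> \<le> exp (- 1) \<longrightarrow> 1 \<le> real (card V) * \<tau> \<longrightarrow>
     spread V r K \<tau> \<mu> \<longrightarrow> 1 \<le> codeg V \<mu> {} \<longrightarrow>
     (\<exists>\<C>. \<C> \<subseteq> Pow V \<and> real (card \<C>) \<le> exp (Q * (real (card V) * \<tau> * ln (1 / \<tau>))) \<and>
        (\<forall>C\<in>\<C>. real (card C) \<le> (1 - c) * real (card V)) \<and>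
        (\<forall>I\<subseteq>V. indep_set \<mu> I \<longrightarrow> (\<exists>C\<in>\<C>. I \<subseteq> C))))"
  using assms
proof (induction r arbitrary: K rule: nat_induct_at_least)
  case base
  show ?case
  \<comment> \<open>The weights allow \<open>1 / K\<close>; halving it keeps \<open>c < 1\<close>
    when \<open>K = 1\<close>.\<close>
  proof (rule exI[of _ "1 / (2 * K)"], rule exI[of _ 1], intro conjI allI impI)
    fix V :: "'a set" and \<mu> and \<tau> :: real
    assume V: "finite V" "V \<noteq> {}" and \<tau>: "0 < \<tau>" "\<tau> \<le> exp (- 1)"
      and \<mu>: "spread V 1 K \<tau> \<mu>" "1 \<le> codeg V \<mu> {}"
    define m where "m = real (card V)"
    have m: "0 < m" using V unfolding m_def by (simp add: card_gt_0_iff)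
    have \<mu>0: "\<And>D. 0 \<le> \<mu> D" and \<mu>supp: "\<And>D. \<mu> D \<noteq> 0 \<Longrightarrow> D \<subseteq> V \<and> card D = 1"
      and \<mu>deg: "\<And>\<sigma>. \<sigma> \<noteq> {} \<Longrightarrow> \<sigma> \<subseteq> V \<Longrightarrow> codeg V \<mu> \<sigma> \<le> K * \<tau> ^ (card \<sigma> - 1) / m"
      using \<mu>(1) unfolding spread_def m_def by auto
    define X where "X = {v \<in> V. \<mu> {v} \<noteq> 0}"
    have finX: "finite X" "X \<subseteq> V" using V by (auto simp: X_def)
    have "1 \<le> (\<Sum>D\<in>Pow V. \<mu> D)" using \<mu>(2) by (simp add: codeg_def Pow_def)
    also have "\<dots> = (\<Sum>D\<in>(\<lambda>v. {v}) ` X. \<mu> D)"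
      using V(1) \<mu>supp by (intro sum.mono_neutral_right) (auto simp: X_def card_1_singleton_iff)
    also have "\<dots> = (\<Sum>v\<in>X. \<mu> {v})" by (subst sum.reindex) auto
    also have "\<dots> \<le> (\<Sum>v\<in>X. K / m)"
    proof (rule sum_mono)
      fix v assume "v \<in> X"
      then have "v \<in> V" by (simp add: X_def)
      have "\<mu> {v} \<le> codeg V \<mu> {v}"
        unfolding codeg_def using V(1) \<mu>0 \<open>v \<in> V\<close> by (intro member_le_sum) auto
      also have "\<dots> \<le> K / m" using \<mu>deg[of "{v}"] \<open>v \<in> V\<close> by simp
      finally show "\<mu> {v} \<le> K / m" .
    qed
    finally have "m \<le> card X * K" using m by (simp add: field_simps)
    then have "m / (2 * K) \<le> card X"
      using base m by (simp add: field_simps)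
    moreover have "real (card (V - X)) = m - card X"
      using finX V(1) unfolding m_def
      by (simp add: card_Diff_subset card_mono of_nat_diff)
    ultimately have "real (card (V - X)) \<le> (1 - 1 / (2 * K)) * m"
      by (simp add: algebra_simps)
    moreover have "I \<subseteq> V - X" if "I \<subseteq> V" "indep_set \<mu> I" for I
      using that unfolding indep_set_def X_def by auto
    moreover have "0 \<le> 1 * (real (card V) * \<tau> * ln (1 / \<tau>))"
    proof -
      have "\<tau> \<le> 1" using \<tau>(2) by (smt (verit) exp_le_one_iff)
      then show ?thesis using \<tau> by (auto intro!: mult_nonneg_nonneg)
    qed
    ultimately show "\<exists>\<C>. \<C> \<subseteq> Pow V \<and> real (card \<C>) \<le> exp (1 * (real (card V) * \<tau> * ln (1 / \<tau>))) \<and>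
        (\<forall>C\<in>\<C>. real (card C) \<le> (1 - 1 / (2 * K)) * real (card V)) \<and>
        (\<forall>I\<subseteq>V. indep_set \<mu> I \<longrightarrow> (\<exists>C\<in>\<C>. I \<subseteq> C))"
      unfolding m_def by (intro exI[of _ "{V - X}"]) auto
  qed (use base in \<open>auto simp: field_simps\<close>)
next
  case (Suc q)
  define B :: real where "B = 4 * 2 ^ q + 16 * K"
  have "0 < (2::real) ^ q" by simp
  then have B: "16 \<le> B" using Suc.prems unfolding B_def by linarith
  have "1 * 1 \<le> (2 * B) * K" using B Suc.prems by (intro mult_mono) auto
  then have K': "1 \<le> 2 * B * K" by simp
  from Suc.IH[OF K'] obtain c' Q' where cQ: "0 < c'" "c' < 1" "0 < Q'" and
    step: "\<And>(V :: 'a set) \<mu> (\<tau> :: real). finite V \<Longrightarrow> V \<noteq> {} \<Longrightarrow> 0 < \<tau> \<Longrightarrow> \<tau> \<le> exp (- 1) \<Longrightarrow>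
     1 \<le> real (card V) * \<tau> \<Longrightarrow> spread V q (2 * B * K) \<tau> \<mu> \<Longrightarrow> 1 \<le> codeg V \<mu> {} \<Longrightarrow>
     (\<exists>\<C>. \<C> \<subseteq> Pow V \<and> real (card \<C>) \<le> exp (Q' * (real (card V) * \<tau> * ln (1 / \<tau>))) \<and>
        (\<forall>C\<in>\<C>. real (card C) \<le> (1 - c') * real (card V)) \<and>
        (\<forall>I\<subseteq>V. indep_set \<mu> I \<longrightarrow> (\<exists>C\<in>\<C>. I \<subseteq> C)))"
    by metis
  \<comment> \<open>Fewer than \<open>c * m\<close> negative answers then meet hyperedges of weight
    at most 1/8.\<close>
  define c where "c = min c' (1 / (8 * K))"
  have c: "0 < c" "c \<le> c'" "c < 1" using cQ Suc.prems by (auto simp: c_def)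
  have "c * K \<le> 1 / (8 * K) * K" using Suc.prems unfolding c_def by (intro mult_right_mono) auto
  then have cK: "c * K \<le> 1 / 8" using Suc.prems by simp
  show ?case
  proof (rule exI[of _ c], rule exI[of _ "Q' + 3"], intro conjI allI impI)
    fix V :: "'a set" and \<mu> and \<tau> :: real
    assume V: "finite V" "V \<noteq> {}" and \<tau>: "0 < \<tau>" "\<tau> \<le> exp (- 1)" "1 \<le> real (card V) * \<tau>"
      and \<mu>: "spread V (Suc q) K \<tau> \<mu>" "1 \<le> codeg V \<mu> {}"
    define m where "m = real (card V)"
    define l where "l = ln (1 / \<tau>)"
    have m: "0 < m" using V unfolding m_def by (simp add: card_gt_0_iff)
    have \<tau>1: "\<tau> \<le> 1" using \<tau>(2) by (smt (verit) exp_le_one_iff)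
    have "ln \<tau> \<le> - 1" using \<tau> by (metis ln_exp ln_mono)
    then have l: "1 \<le> l" using \<tau> by (simp add: l_def ln_div)
    define N where "N = exp (Q' * (m * \<tau> * l))"
    have N: "1 \<le> N" using cQ m \<tau> l by (auto simp: N_def intro!: mult_nonneg_nonneg)
    \<comment> \<open>Every positive answer adds at least \<open>B / (2 * m * \<tau>)\<close>, so
      this many lift the zero weight to total weight 1.\<close>
    define y where "y = nat \<lceil>2 * m * \<tau> / B\<rceil>"
    have "0 \<le> 2 * m * \<tau> / B" using m \<tau> B by (intro divide_nonneg_nonneg) auto
    then have y: "2 * m * \<tau> / B \<le> y" "y \<le> 2 * m * \<tau> / B + 1"
      unfolding y_def by (auto simp: of_nat_nat)
    have link: "\<exists>\<C>. \<C> \<subseteq> Pow V \<and> real (card \<C>) \<le> N \<and> (\<forall>C\<in>\<C>. real (card C) \<le> (1 - c) * real (card V)) \<and>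
        (\<forall>I\<subseteq>V. indep_set \<nu> I \<longrightarrow> (\<exists>C\<in>\<C>. I \<subseteq> C))"
      if "spread V q (2 * B * K) \<tau> \<nu>" "1 \<le> codeg V \<nu> {}" for \<nu>
    proof -
      have "(1 - c') * real (card V) \<le> (1 - c) * real (card V)"
        using c by (intro mult_right_mono) auto
      then show ?thesis using step[OF V \<tau> that] unfolding N_def m_def l_def by (meson order_trans)
    qed
    have "\<exists>\<C>. \<C> \<subseteq> Pow V \<and> real (card \<C>) \<le> (1 / \<tau>) ^ y * (1 + \<tau>) ^ card V * N \<and>
        (\<forall>C\<in>\<C>. real (card C) \<le> (1 - c) * real (card V)) \<and>
        (\<forall>I\<subseteq>V. I \<inter> {} = {} \<and> indep_set \<mu> I \<and> indep_set (\<lambda>_. 0) I \<longrightarrow> (\<exists>C\<in>\<C>. I \<subseteq> C))"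
    proof (rule container_step_inner[OF V \<mu> \<tau>(1) \<tau>1 _ _ N c(1) cK link])
      show "spread V q (2 * B * K) \<tau> (\<lambda>_. 0)"
        using \<tau> B Suc.prems by (auto simp: spread_def codeg_def)
      show "1 \<le> codeg V (\<lambda>_. 0) {} + real y * (B / (2 * real (card V) * \<tau>))"
        using y(1) m \<tau>(1) B unfolding m_def by (simp add: codeg_def field_simps)
    qed (use Suc.prems in \<open>auto simp: B_def codeg_def\<close>)
    then obtain \<C> where \<C>: "\<C> \<subseteq> Pow V" "real (card \<C>) \<le> (1 / \<tau>) ^ y * (1 + \<tau>) ^ card V * N"
      "\<forall>C\<in>\<C>. real (card C) \<le> (1 - c) * real (card V)"
      "\<forall>I\<subseteq>V. indep_set \<mu> I \<longrightarrow> (\<exists>C\<in>\<C>. I \<subseteq> C)"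
      by (auto simp: indep_set_def)
    have "(1 / \<tau>) ^ y = exp (y * l)" using \<tau> by (simp add: l_def exp_of_nat_mult)
    moreover have "(1 + \<tau>) ^ card V \<le> exp \<tau> ^ card V"
      using \<tau> exp_ge_add_one_self by (intro power_mono) auto
    then have "(1 + \<tau>) ^ card V \<le> exp (m * \<tau>)" by (simp add: m_def exp_of_nat_mult)
    ultimately have "(1 / \<tau>) ^ y * (1 + \<tau>) ^ card V * N \<le> exp (y * l) * exp (m * \<tau>) * N"
      using N \<tau> by (intro mult_mono) auto
    also have "\<dots> = exp (y * l + m * \<tau> + Q' * (m * \<tau> * l))" by (simp add: exp_add N_def)
    also have "\<dots> \<le> exp ((Q' + 3) * (m * \<tau> * l))"
    proof -
      have "2 * m * \<tau> / B \<le> m * \<tau>"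
        using B m \<tau> mult_left_mono[of 2 B "m * \<tau>"] by (simp add: field_simps)
      then have "y \<le> 2 * (m * \<tau>)" using y(2) \<tau>(3) unfolding m_def by linarith
      then have "y * l \<le> 2 * (m * \<tau>) * l" using l by (intro mult_right_mono) auto
      moreover have "m * \<tau> * 1 \<le> m * \<tau> * l" using l m \<tau> by (intro mult_left_mono) auto
      ultimately show ?thesis by (simp add: algebra_simps)
    qed
    finally have "real (card \<C>) \<le> exp ((Q' + 3) * (m * \<tau> * l))" using \<C>(2) by linarith
    then show "\<exists>\<C>. \<C> \<subseteq> Pow V \<and> real (card \<C>) \<le> exp ((Q' + 3) * (real (card V) * \<tau> * ln (1 / \<tau>))) \<and>
        (\<forall>C\<in>\<C>. real (card C) \<le> (1 - c) * real (card V)) \<and>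
        (\<forall>I\<subseteq>V. indep_set \<mu> I \<longrightarrow> (\<exists>C\<in>\<C>. I \<subseteq> C))"
      using \<C> unfolding m_def l_def by blast
  qed (use c cQ in auto)
qed

subsection \<open>Balanced families of complete bipartite graphs\<close>

lemma exists_disjoint_blocks:
  fixes N :: "'a set"
  assumes "finite N" "1 \<le> D"
  shows "\<exists>P. finite P \<and> (\<forall>Z\<in>P. Z \<subseteq> N \<and> card Z = D) \<and> pairwise disjnt P \<and> card N \<le> D * card P + D"
  using assms(1)
proof (induction "card N" arbitrary: N rule: less_induct)
  case less
  show ?case
  proof (cases "card N < D")
    case True
    then show ?thesis by (intro exI[of _ "{}"]) auto
  next
    case False
    then obtain Z where Z: "Z \<subseteq> N" "card Z = D"
      by (meson linorder_not_less obtain_subset_with_card_n)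
    have finZ: "finite Z" using Z less.prems finite_subset by auto
    have c: "card (N - Z) = card N - D" using Z finZ by (simp add: card_Diff_subset)
    then have "card (N - Z) < card N" using False assms(2) by auto
    from less.hyps[OF this] less.prems obtain P where
      P: "finite P" "\<forall>Z'\<in>P. Z' \<subseteq> N - Z \<and> card Z' = D" "pairwise disjnt P" "card (N - Z) \<le> D * card P + D"
      by auto
    have "Z \<noteq> {}" using Z(2) assms(2) by auto
    then have "Z \<notin> P" using P(2) by blast
    have "pairwise disjnt (insert Z P)"
      unfolding pairwise_insert using P by (auto simp: disjnt_def)
    then show ?thesis using P Z c False \<open>Z \<notin> P\<close>
      by (intro exI[of _ "insert Z P"]) auto
  qed
qed

text \<open>A random \<open>t\<close>-subset of \<open>d\<close> points contains \<open>b\<close>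
  given points with probability the product of \<open>(t - i) / (d - i)\<close> over
  \<open>i < b\<close>, and no factor exceeds \<open>t / d\<close>.\<close>

lemma binomial_diff_le:
  assumes "b \<le> t" "t \<le> d" "0 < d"
  shows "real ((d - b) choose (t - b)) \<le> (real t / real d) ^ b * real (d choose t)"
  using assms(1)
proof (induction b)
  case (Suc b)
  then have bt: "b < t" by simp
  have "(t - b) * ((d - b) choose (t - b)) = (d - b) * ((d - Suc b) choose (t - Suc b))"
    using times_binomial_minus1_eq[of "t - b" "d - b"] bt by simp
  then have eq: "real (d - b) * real ((d - Suc b) choose (t - Suc b))
      = real (t - b) * real ((d - b) choose (t - b))"
    by (metis of_nat_mult)
  have db: "0 < real (d - b)" using bt assms by simp
  have "real (t - b) * real d \<le> real t * real (d - b)"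
    using bt assms by (simp add: of_nat_diff algebra_simps mult_left_mono)
  then have ratio: "real (t - b) / real (d - b) \<le> real t / real d"
    using db assms by (simp add: field_simps)
  have "real ((d - Suc b) choose (t - Suc b))
      = real (t - b) / real (d - b) * real ((d - b) choose (t - b))"
    using eq db by (simp add: field_simps)
  also have "\<dots> \<le> real t / real d * ((real t / real d) ^ b * real (d choose t))"
    using ratio Suc bt by (intro mult_mono) auto
  finally show ?case by simp
qed simp

text \<open>Removing \<open>R\<close> is injective on its supersets. Only an inequality holds in
  general: if \<open>t < card R\<close>, truncated subtraction makes the right side 1 although there
  is no such \<open>T\<close>.\<close>

lemma card_supersets_le:
  assumes "finite N" "R \<subseteq> N"
  shows "card {T. T \<subseteq> N \<and> card T = t \<and> R \<subseteq> T} \<le> (card N - card R) choose (t - card R)"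
proof -
  have "card {T. T \<subseteq> N \<and> card T = t \<and> R \<subseteq> T} \<le> card {T. T \<subseteq> N - R \<and> card T = t - card R}"
  proof (rule card_inj_on_le[where f = "\<lambda>T. T - R"])
    show "inj_on (\<lambda>T. T - R) {T. T \<subseteq> N \<and> card T = t \<and> R \<subseteq> T}"
      by (auto simp: inj_on_def)
    show "finite {T. T \<subseteq> N - R \<and> card T = t - card R}" using assms by simp
    have "finite R" using assms finite_subset by auto
    then show "(\<lambda>T. T - R) ` {T. T \<subseteq> N \<and> card T = t \<and> R \<subseteq> T}
        \<subseteq> {T. T \<subseteq> N - R \<and> card T = t - card R}"
      by (auto simp: card_Diff_subset)
  qed
  also have "\<dots> = (card N - card R) choose (t - card R)"
    using assms by (simp add: n_subsets card_Diff_subset finite_subset)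
  finally show ?thesis .
qed

text \<open>\<open>FD\<close> keeps at least half of the edges inside blocks, and \<open>FL\<close>
  makes the discarded \<open>S\<close> account for at most half of the incidences between sets
  \<open>S\<close> and blocks, so about \<open>card F * D ^ (s - 1)\<close> incidences remain. In
  the final bound the first vertex on each side together cost \<open>1 / card F\<close>; each
  further one costs \<open>1 / D\<close> on the left and \<open>1 / L\<close> on the right.\<close>

lemma balanced_bipartite_copies:
  fixes F :: "('a \<times> 'b) set" and L :: real
  assumes XY: "finite X" "finite Y" "F \<subseteq> X \<times> Y" "card X \<le> n" "card Y \<le> n"
    and s: "1 \<le> s" "s \<le> D" and t: "1 \<le> t" "real t \<le> L"
    and FD: "F \<noteq> {}" "2 * n * D \<le> card F"
    and FL: "4 * real s ^ s * real n ^ s * L \<le> real (card F) * real D ^ (s - 1)"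
  shows "\<exists>w. (\<forall>p. 0 \<le> w p) \<and> (\<forall>S T. w (S, T) \<noteq> 0 \<longrightarrow> S \<times> T \<subseteq> F \<and> card S = s \<and> card T = t) \<and>
    (\<Sum>p\<in>Pow X \<times> Pow Y. w p) = 1 \<and>
    (\<forall>R\<subseteq>F. R \<noteq> {} \<longrightarrow> (\<Sum>p\<in>{p \<in> Pow X \<times> Pow Y. R \<subseteq> fst p \<times> snd p}. w p)
       \<le> 4 * real s ^ s * real t ^ t /
          (real (card F) * real D ^ (card (fst ` R) - 1) * L ^ (card (snd ` R) - 1)))"
proof -
  have finF: "finite F" using XY finite_subset by auto
  have D: "1 \<le> D" using s by simp
  define N where "N = (\<lambda>y. {x. (x, y) \<in> F})"
  have NX: "N y \<subseteq> X" for y using XY(3) by (auto simp: N_def)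
  then have finN: "finite (N y)" for y using XY(1) finite_subset by blast
  have "\<exists>P. \<forall>y. finite (P y) \<and> (\<forall>Z\<in>P y. Z \<subseteq> N y \<and> card Z = D) \<and> pairwise disjnt (P y) \<and>
      card (N y) \<le> D * card (P y) + D"
    using exists_disjoint_blocks[OF finN D] by metis
  then obtain P where P: "\<And>y. finite (P y)" "\<And>y Z. Z \<in> P y \<Longrightarrow> Z \<subseteq> N y"
    "\<And>y Z. Z \<in> P y \<Longrightarrow> card Z = D" "\<And>y. pairwise disjnt (P y)"
    "\<And>y. card (N y) \<le> D * card (P y) + D" by metis
  have finZ: "finite Z" if "Z \<in> P y" for y Z using P(2)[OF that] finN finite_subset by auto
  have uniq: "Z = Z'" if "Z \<in> P y" "Z' \<in> P y" "x \<in> Z" "x \<in> Z'" for y Z Z' x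
    using P(4)[of y] that unfolding pairwise_def disjnt_def by blast
  define M where "M = (\<Sum>y\<in>Y. card (P y))"
  have "bij_betw prod.swap F (SIGMA y:Y. N y)"
    using XY(3) by (intro bij_betw_byWitness[where f' = prod.swap]) (auto simp: N_def)
  then have "card F = card (SIGMA y:Y. N y)" by (rule bij_betw_same_card)
  also have "\<dots> = (\<Sum>y\<in>Y. card (N y))" using XY(2) finN by simp
  also have "\<dots> \<le> (\<Sum>y\<in>Y. D * card (P y) + D)" by (intro sum_mono P(5))
  also have "\<dots> = D * M + card Y * D" by (simp add: sum.distrib M_def sum_distrib_left)
  also have "\<dots> \<le> D * M + n * D" using XY(5) by simp
  \<comment> \<open>Cutting into blocks leaves out at most \<open>D\<close> edges per vertex of
    \<open>Y\<close>, by \<open>FD\<close> at most half of \<open>F\<close> in total.\<close>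
  finally have "card F \<le> 2 * D * M" using FD(2) by simp
  then have FM: "real (card F) \<le> 2 * real D * real M"
    by (metis of_nat_le_iff of_nat_mult of_nat_numeral)
  define \<S> where "\<S> = {S. S \<subseteq> X \<and> card S = s}"
  have fin\<S>: "finite \<S>" using XY(1) by (simp add: \<S>_def)
  \<comment> \<open>Blocks of the same \<open>y\<close> are disjoint and an \<open>s\<close>-set is
    non-empty, so it lies in at most one block of \<open>y\<close>: counting vertices
    \<open>y\<close> counts blocks.\<close>
  define NB where "NB = (\<lambda>S. {y \<in> Y. \<exists>Z\<in>P y. S \<subseteq> Z})"
  have NBY: "NB S \<subseteq> Y" and finNB: "finite (NB S)" for S using XY(2) by (auto simp: NB_def)
  define d where "d = (\<lambda>S. card (NB S))"
  have "(\<Sum>S\<in>\<S>. real (d S)) = (\<Sum>S\<in>\<S>. \<Sum>y\<in>Y. if \<exists>Z\<in>P y. S \<subseteq> Z then 1 else 0)"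
    using XY(2) by (simp add: d_def NB_def sum.If_cases Int_def)
  also have "\<dots> = (\<Sum>y\<in>Y. \<Sum>S\<in>\<S>. if \<exists>Z\<in>P y. S \<subseteq> Z then 1 else 0)" by (rule sum.swap)
  also have "\<dots> = (\<Sum>y\<in>Y. real (card {S \<in> \<S>. \<exists>Z\<in>P y. S \<subseteq> Z}))"
    using fin\<S> by (simp add: sum.If_cases Int_def)
  also have "\<dots> = (\<Sum>y\<in>Y. real (card (P y)) * real (D choose s))"
  proof (rule sum.cong[OF refl])
    fix y
    have "{S \<in> \<S>. \<exists>Z\<in>P y. S \<subseteq> Z} = (\<Union>Z\<in>P y. {S. S \<subseteq> Z \<and> card S = s})"
      using P(2)[of _ y] NX[of y] by (auto simp: \<S>_def)
    also have "card \<dots> = (\<Sum>Z\<in>P y. card {S. S \<subseteq> Z \<and> card S = s})"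
    proof (rule card_UN_disjoint)
      show "\<forall>Z\<in>P y. finite {S. S \<subseteq> Z \<and> card S = s}" using finZ by simp
      show "\<forall>Z\<in>P y. \<forall>Z'\<in>P y. Z \<noteq> Z' \<longrightarrow>
          {S. S \<subseteq> Z \<and> card S = s} \<inter> {S. S \<subseteq> Z' \<and> card S = s} = {}"
      proof (intro ballI impI)
        fix Z Z' assume Z: "Z \<in> P y" "Z' \<in> P y" "Z \<noteq> Z'"
        have False if "S \<subseteq> Z" "S \<subseteq> Z'" "card S = s" for S
        proof -
          have "S \<noteq> {}" using that(3) s(1) by auto
          then show False using uniq[OF Z(1,2)] that Z(3) by blast
        qed
        then show "{S. S \<subseteq> Z \<and> card S = s} \<inter> {S. S \<subseteq> Z' \<and> card S = s} = {}" by blast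
      qed
    qed (rule P(1))
    also have "\<dots> = (\<Sum>Z\<in>P y. D choose s)"
      by (intro sum.cong refl) (simp add: n_subsets[OF finZ] P(3))
    finally show "real (card {S \<in> \<S>. \<exists>Z\<in>P y. S \<subseteq> Z}) = real (card (P y)) * real (D choose s)"
      by simp
  qed
  finally have sumd: "(\<Sum>S\<in>\<S>. real (d S)) = real M * real (D choose s)"
    by (simp add: M_def sum_distrib_right)
  define \<S>g where "\<S>g = {S \<in> \<S>. L \<le> d S}"
  define W where "W = (\<Sum>S\<in>\<S>g. real (d S))"
  have s0: "0 < real s ^ s" using s by simp
  have "real D ^ s = real D * real D ^ (s - 1)" using s by (simp add: power_eq_if)
  moreover have "real D ^ s / real s ^ s \<le> real (D choose s)"
    using binomial_ge_n_over_k_pow_k[OF s(2), where 'a = real] by (simp add: power_divide)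
  then have "real D ^ s \<le> real s ^ s * real (D choose s)"
    using s0 by (simp add: pos_divide_le_eq mult.commute)
  ultimately have "real D * real D ^ (s - 1) \<le> real s ^ s * real (D choose s)" by simp
  then have "2 * real M * (real D * real D ^ (s - 1)) \<le> 2 * real M * (real s ^ s * real (D choose s))"
    by (intro mult_left_mono) auto
  moreover have "real (card F) * real D ^ (s - 1) \<le> 2 * real D * real M * real D ^ (s - 1)"
    using FM by (intro mult_right_mono) auto
  ultimately have tot: "real (card F) * real D ^ (s - 1) \<le> 2 * real s ^ s * (\<Sum>S\<in>\<S>. real (d S))"
    unfolding sumd by (simp add: mult_ac)
  \<comment> \<open>There are at most \<open>n ^ s\<close> sets \<open>S\<close>, so those below the
    threshold contribute at most \<open>n ^ s * L\<close>.\<close>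
  have "(\<Sum>S\<in>\<S>. real (d S)) = W + (\<Sum>S\<in>\<S> - \<S>g. real (d S))"
    using sum.subset_diff[of \<S>g \<S>] fin\<S> unfolding W_def by (simp add: \<S>g_def add.commute)
  also have "(\<Sum>S\<in>\<S> - \<S>g. real (d S)) \<le> (\<Sum>S\<in>\<S> - \<S>g. L)"
    by (intro sum_mono) (auto simp: \<S>g_def)
  also have "\<dots> = real (card (\<S> - \<S>g)) * L" by simp
  also have "\<dots> \<le> real n ^ s * L"
  proof -
    have "card (\<S> - \<S>g) \<le> card \<S>" using fin\<S> by (intro card_mono) auto
    also have "\<dots> = card X choose s" using XY(1) by (simp add: \<S>_def n_subsets)
    also have "\<dots> \<le> card X ^ s"
      by (cases "s \<le> card X") (simp_all add: binomial_le_pow binomial_eq_0)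
    also have "\<dots> \<le> n ^ s" using XY(4) by (rule power_mono) simp
    finally have "real (card (\<S> - \<S>g)) \<le> real n ^ s" by (metis of_nat_le_iff of_nat_power)
    then show ?thesis using t by (intro mult_right_mono) auto
  qed
  finally have "2 * real s ^ s * (\<Sum>S\<in>\<S>. real (d S)) \<le> 2 * real s ^ s * (W + real n ^ s * L)"
    using s0 by (intro mult_left_mono) auto
  then have W: "real (card F) * real D ^ (s - 1) \<le> 4 * real s ^ s * W"
    using tot FL by (simp add: algebra_simps)
  have F0: "0 < real (card F)" using FD(1) finF by (simp add: card_gt_0_iff)
  then have "0 < real (card F) * real D ^ (s - 1)" using D by simp
  then have "0 < 4 * real s ^ s * W" using W by linarith
  then have W0: "0 < W" using s0 by (simp add: zero_less_mult_iff)
  have L0: "1 \<le> L" using t by linarith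
  have dg: "L \<le> d S" "t \<le> d S" "0 < d S" "0 < d S choose t" if "S \<in> \<S>g" for S
  proof -
    show a: "L \<le> d S" using that by (simp add: \<S>g_def)
    then show b: "t \<le> d S" using t by linarith
    then show "0 < d S" "0 < d S choose t" using t by auto
  qed
  \<comment> \<open>\<open>S\<close> has probability \<open>d S / W\<close>; given \<open>S\<close>,
    the set \<open>T\<close> is uniform among the \<open>t\<close>-subsets of
    \<open>NB S\<close>.\<close>
  define w where "w = (\<lambda>p. if fst p \<in> \<S>g \<and> snd p \<subseteq> NB (fst p) \<and> card (snd p) = t
     then real (d (fst p)) / (real (d (fst p) choose t) * W) else 0)"
  have finXY: "finite (Pow X \<times> Pow Y)" using XY by auto
  show ?thesis
  proof (intro exI[of _ w] conjI allI impI)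
    fix p show "0 \<le> w p" using W0 by (auto simp: w_def)
  next
    fix S T assume "w (S, T) \<noteq> 0"
    then have ST: "S \<in> \<S>" "T \<subseteq> NB S" "card T = t" by (auto simp: w_def \<S>g_def split: if_splits)
    then show "card S = s" "card T = t" by (auto simp: \<S>_def)
    show "S \<times> T \<subseteq> F" using ST(2) P(2) unfolding NB_def N_def by blast
  next
    have "(\<Sum>p\<in>Pow X \<times> Pow Y. w p) = (\<Sum>p\<in>Sigma \<S>g (\<lambda>S. {T. T \<subseteq> NB S \<and> card T = t}). w p)"
      using finXY NBY by (intro sum.mono_neutral_right) (auto simp: w_def \<S>g_def \<S>_def)
    also have "\<dots> = (\<Sum>S\<in>\<S>g. \<Sum>T\<in>{T. T \<subseteq> NB S \<and> card T = t}. w (S, T))"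
      using fin\<S> finNB by (subst sum.Sigma) (auto simp: \<S>g_def)
    also have "\<dots> = (\<Sum>S\<in>\<S>g. real (d S) / W)"
    proof (rule sum.cong[OF refl])
      fix S assume S: "S \<in> \<S>g"
      have "(\<Sum>T\<in>{T. T \<subseteq> NB S \<and> card T = t}. w (S, T))
          = (\<Sum>T\<in>{T. T \<subseteq> NB S \<and> card T = t}. real (d S) / (real (d S choose t) * W))"
        using S by (intro sum.cong) (auto simp: w_def)
      also have "\<dots> = real (d S choose t) * (real (d S) / (real (d S choose t) * W))"
        by (simp add: n_subsets[OF finNB] d_def)
      also have "\<dots> = real (d S) / W" using dg(4)[OF S] by simp
      finally show "(\<Sum>T\<in>{T. T \<subseteq> NB S \<and> card T = t}. w (S, T)) = real (d S) / W" .
    qed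
    also have "\<dots> = 1" using W0 by (simp add: sum_divide_distrib[symmetric] W_def)
    finally show "(\<Sum>p\<in>Pow X \<times> Pow Y. w p) = 1" .
  next
    fix R assume R: "R \<subseteq> F" "R \<noteq> {}"
    define A where "A = fst ` R"
    define B where "B = snd ` R"
    define a where "a = card A"
    define b where "b = card B"
    have "finite R" using R(1) finF finite_subset by auto
    then have finAB: "finite A" "finite B" by (auto simp: A_def B_def)
    have ne: "A \<noteq> {}" "B \<noteq> {}" using R(2) by (auto simp: A_def B_def)
    then have ab: "1 \<le> a" "1 \<le> b" using finAB by (auto simp: a_def b_def Suc_le_eq card_gt_0_iff)
    obtain y0 where y0: "y0 \<in> B" using ne by auto
    define \<S>R where "\<S>R = {S \<in> \<S>g. A \<subseteq> S \<and> B \<subseteq> NB S}"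
    have fin\<S>R: "finite \<S>R" using fin\<S> by (auto simp: \<S>R_def \<S>g_def)
    define \<T> where "\<T> = (\<lambda>S. {T. T \<subseteq> NB S \<and> card T = t \<and> B \<subseteq> T})"
    have incl: "R \<subseteq> S \<times> T \<longleftrightarrow> A \<subseteq> S \<and> B \<subseteq> T" for S :: "'a set" and T :: "'b set"
      unfolding A_def B_def by force
    have sumR: "(\<Sum>p\<in>{p \<in> Pow X \<times> Pow Y. R \<subseteq> fst p \<times> snd p}. w p) = (\<Sum>S\<in>\<S>R. \<Sum>T\<in>\<T> S. w (S, T))"
    proof -
      have "(\<Sum>p\<in>{p \<in> Pow X \<times> Pow Y. R \<subseteq> fst p \<times> snd p}. w p) = (\<Sum>p\<in>Sigma \<S>R \<T>. w p)"
        using finXY NBY unfolding incl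
        by (intro sum.mono_neutral_right) (auto simp: w_def \<S>g_def \<S>_def \<S>R_def \<T>_def)
      then show ?thesis using fin\<S>R finNB by (subst sum.Sigma) (auto simp: \<T>_def)
    qed
    have inner: "(\<Sum>T\<in>\<T> S. w (S, T)) \<le> real t ^ t / (W * L ^ (b - 1))" if S: "S \<in> \<S>R" for S
    proof (cases "b \<le> t")
      case True
      have Sg: "S \<in> \<S>g" and BN: "B \<subseteq> NB S" using S by (auto simp: \<S>R_def)
      note dg = dg[OF Sg]
      have "card (\<T> S) \<le> (d S - b) choose (t - b)"
        unfolding \<T>_def d_def b_def by (rule card_supersets_le[OF finNB BN])
      then have "real (card (\<T> S)) \<le> real ((d S - b) choose (t - b))" by simp
      also have "\<dots> \<le> (real t / real (d S)) ^ b * real (d S choose t)"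
        by (rule binomial_diff_le[OF True dg(2,3)])
      finally have cT: "real (card (\<T> S)) \<le> (real t / real (d S)) ^ b * real (d S choose t)" .
      have "(\<Sum>T\<in>\<T> S. w (S, T)) = real (card (\<T> S)) * (real (d S) / (real (d S choose t) * W))"
        using Sg by (simp add: w_def \<T>_def)
      also have "\<dots> \<le> (real t / real (d S)) ^ b * real (d S choose t) * (real (d S) / (real (d S choose t) * W))"
        using cT W0 by (intro mult_right_mono) auto
      \<comment> \<open>The weight \<open>d S\<close> of \<open>S\<close> cancels one of the
        \<open>b\<close> factors \<open>1 / d S\<close>; the threshold bounds the other
        \<open>b - 1\<close>.\<close>
      also have "\<dots> = real t ^ b / (W * real (d S) ^ (b - 1))"
      proof -
        obtain b' where "b = Suc b'" using ab(2) by (cases b) auto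
        then show ?thesis using dg by (simp add: power_divide field_simps)
      qed
      also have "\<dots> \<le> real t ^ t / (W * L ^ (b - 1))"
        using True dg(1) L0 t W0
        by (intro frac_le mult_left_mono power_mono power_increasing) auto
      finally show ?thesis .
    next
      case False
      have "\<T> S = {}"
      proof (rule ccontr)
        assume "\<T> S \<noteq> {}"
        then obtain T where T: "T \<subseteq> NB S" "card T = t" "B \<subseteq> T" by (auto simp: \<T>_def)
        then have "b \<le> t" using finNB finite_subset unfolding b_def by (metis card_mono)
        then show False using False by simp
      qed
      then show ?thesis using W0 L0 by simp
    qed
    \<comment> \<open>Any one vertex \<open>y0\<close> of \<open>B\<close> suffices: all
      \<open>S\<close> in question contain \<open>A\<close>, which is non-empty, hence lie in the
      same block of \<open>y0\<close>.\<close>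
    have card\<S>R: "real (card \<S>R) * real D ^ (a - 1) \<le> real D ^ (s - 1)"
    proof (cases "\<S>R = {}")
      case False
      then obtain S1 where S1: "S1 \<in> \<S>R" by auto
      then have "y0 \<in> NB S1" "A \<subseteq> S1" "card S1 = s" "S1 \<subseteq> X"
        using y0 by (auto simp: \<S>R_def \<S>g_def \<S>_def)
      then have as: "a \<le> s" using XY(1) finite_subset unfolding a_def by (metis card_mono)
      obtain Z where Z: "Z \<in> P y0" "S1 \<subseteq> Z" using \<open>y0 \<in> NB S1\<close> by (auto simp: NB_def)
      then have AZ: "A \<subseteq> Z" using \<open>A \<subseteq> S1\<close> by auto
      have "\<S>R \<subseteq> {S. S \<subseteq> Z \<and> card S = s \<and> A \<subseteq> S}"
      proof
        fix S assume S: "S \<in> \<S>R"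
        then have "y0 \<in> NB S" "A \<subseteq> S" "card S = s"
          using y0 by (auto simp: \<S>R_def \<S>g_def \<S>_def)
        then obtain Z' where "Z' \<in> P y0" "S \<subseteq> Z'" by (auto simp: NB_def)
        moreover obtain x where "x \<in> A" using ne by auto
        ultimately have "Z' = Z" using uniq[of Z' y0 Z x] Z AZ \<open>A \<subseteq> S\<close> by blast
        then show "S \<in> {S. S \<subseteq> Z \<and> card S = s \<and> A \<subseteq> S}"
          using \<open>S \<subseteq> Z'\<close> \<open>A \<subseteq> S\<close> \<open>card S = s\<close> by simp
      qed
      then have "card \<S>R \<le> card {S. S \<subseteq> Z \<and> card S = s \<and> A \<subseteq> S}"
        using finZ[OF Z(1)] by (intro card_mono) auto
      also have "\<dots> \<le> (D - a) choose (s - a)"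
        using card_supersets_le[OF finZ[OF Z(1)] AZ] P(3)[OF Z(1)] by (simp add: a_def)
      also have "\<dots> \<le> (D - a) ^ (s - a)"
        using s(2) as by (intro binomial_le_pow) simp
      also have "\<dots> \<le> D ^ (s - a)" by (intro power_mono) auto
      finally have "card \<S>R * D ^ (a - 1) \<le> D ^ (s - a) * D ^ (a - 1)" by simp
      also have "\<dots> = D ^ (s - 1)" using as ab by (simp add: power_add[symmetric])
      finally show ?thesis by (metis of_nat_le_iff of_nat_mult of_nat_power)
    qed simp
    have "(\<Sum>S\<in>\<S>R. \<Sum>T\<in>\<T> S. w (S, T)) \<le> (\<Sum>S\<in>\<S>R. real t ^ t / (W * L ^ (b - 1)))"
      by (intro sum_mono inner)
    also have "\<dots> = real (card \<S>R) * (real t ^ t / (W * L ^ (b - 1)))" by simp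
    also have "\<dots> \<le> 4 * real s ^ s * real t ^ t / (real (card F) * real D ^ (a - 1) * L ^ (b - 1))"
    proof -
      have "real (card \<S>R) * (real (card F) * real D ^ (a - 1))
          = real (card F) * (real (card \<S>R) * real D ^ (a - 1))" by simp
      also have "\<dots> \<le> real (card F) * real D ^ (s - 1)" by (intro mult_left_mono card\<S>R) auto
      also have "\<dots> \<le> 4 * real s ^ s * W" by (rule W)
      finally have "real (card \<S>R) * (real (card F) * real D ^ (a - 1)) \<le> 4 * real s ^ s * W" .
      then have "real (card \<S>R) / W \<le> 4 * real s ^ s / (real (card F) * real D ^ (a - 1))"
        using W0 F0 D by (simp add: field_simps)
      then have "real (card \<S>R) / W * (real t ^ t / L ^ (b - 1))
          \<le> 4 * real s ^ s / (real (card F) * real D ^ (a - 1)) * (real t ^ t / L ^ (b - 1))"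
        using L0 by (intro mult_right_mono) auto
      then show ?thesis by simp
    qed
    finally show "(\<Sum>p\<in>{p \<in> Pow X \<times> Pow Y. R \<subseteq> fst p \<times> snd p}. w p)
       \<le> 4 * real s ^ s * real t ^ t /
          (real (card F) * real D ^ (card (fst ` R) - 1) * L ^ (card (snd ` R) - 1))"
      unfolding sumR a_def b_def A_def B_def .
  qed
qed

section \<open>From bipartite graphs to arbitrary graphs\<close>

abbreviation pairs_on :: "'a set \<Rightarrow> 'a set set" where
  "pairs_on V \<equiv> {e. e \<subseteq> V \<and> card e = 2}"

definition bipartite_edges :: "'a set \<times> 'a set \<Rightarrow> 'a set set" where
  "bipartite_edges p = (\<lambda>(x, y). {x, y}) ` (fst p \<times> snd p)"

text \<open>Vertices are placed one at a time, each on the side that cuts at least half of its edges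
  to earlier vertices. The condition \<open>card (e \<inter> A) = 1\<close> says that
  \<open>e\<close> crosses the cut.\<close>

lemma exists_large_cut:
  assumes "finite V" "E \<subseteq> pairs_on V"
  shows "\<exists>A\<subseteq>V. card E \<le> 2 * card {e \<in> E. card (e \<inter> A) = 1}"
  using assms
proof (induction V arbitrary: E rule: finite_induct)
  case empty
  then have "E = {}" by auto
  then show ?case by auto
next
  case (insert v W)
  define E0 where "E0 = {e \<in> E. v \<notin> e}"
  have "E0 \<subseteq> pairs_on W" using insert.prems by (auto simp: E0_def)
  from insert.IH[OF this] obtain A where
    A: "A \<subseteq> W" "card E0 \<le> 2 * card {e \<in> E0. card (e \<inter> A) = 1}" by auto
  have vA: "v \<notin> A" using A insert.hyps by auto
  define P where "P = {e \<in> E. v \<in> e \<and> e \<inter> A \<noteq> {}}"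
  define Q where "Q = {e \<in> E. v \<in> e \<and> e \<inter> A = {}}"
  have finE: "finite E"
    by (rule finite_subset[of _ "Pow (insert v W)"]) (use insert in auto)
  have "card E \<le> card E0 + card P + card Q"
  proof -
    have "E = (E0 \<union> P) \<union> Q" by (auto simp: E0_def P_def Q_def)
    then have "card E \<le> card (E0 \<union> P) + card Q" by (metis card_Un_le)
    also have "card (E0 \<union> P) \<le> card E0 + card P" by (rule card_Un_le)
    finally show ?thesis by simp
  qed
  have PA: "card (e \<inter> A) = 1" if "e \<in> P" for e
  proof -
    have e: "card e = 2" "v \<in> e" "e \<inter> A \<noteq> {}" using that insert.prems by (auto simp: P_def)
    then obtain u where "e = {v, u}" "u \<noteq> v" by (metis card_2_iff' card_2_iff insert_iff insert_commute singletonD)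
    then have "e \<inter> A = {u}" using e vA by auto
    then show ?thesis by simp
  qed
  have QA: "e \<inter> insert v A = {v}" if "e \<in> Q" for e
    using that by (auto simp: Q_def)
  show ?case
  proof (cases "card Q \<le> card P")
    case True
    have "card {e \<in> E0. card (e \<inter> A) = 1} + card P = card ({e \<in> E0. card (e \<inter> A) = 1} \<union> P)"
      using finE by (subst card_Un_disjoint) (auto simp: E0_def P_def)
    also have "\<dots> \<le> card {e \<in> E. card (e \<inter> A) = 1}"
    proof (rule card_mono)
      show "{e \<in> E0. card (e \<inter> A) = 1} \<union> P \<subseteq> {e \<in> E. card (e \<inter> A) = 1}"
        using PA by (auto simp: E0_def P_def)
    qed (use finE in auto)
    finally show ?thesis using A True \<open>card E \<le> card E0 + card P + card Q\<close>
      by (intro exI[of _ A]) auto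
  next
    case False
    have "card {e \<in> E0. card (e \<inter> A) = 1} + card Q = card ({e \<in> E0. card (e \<inter> A) = 1} \<union> Q)"
      using finE by (subst card_Un_disjoint) (auto simp: E0_def Q_def)
    also have "\<dots> \<le> card {e \<in> E. card (e \<inter> insert v A) = 1}"
    proof (rule card_mono)
      have "e \<inter> insert v A = e \<inter> A" if "e \<in> E0" for e using that by (auto simp: E0_def)
      then show "{e \<in> E0. card (e \<inter> A) = 1} \<union> Q \<subseteq> {e \<in> E. card (e \<inter> insert v A) = 1}"
        using QA by (auto simp: E0_def Q_def)
    qed (use finE in auto)
    finally show ?thesis using A False \<open>card E \<le> card E0 + card P + card Q\<close>
      by (intro exI[of _ "insert v A"]) auto
  qed
qed

text \<open>If \<open>a = s\<close>, \<open>b = t\<close> and \<open>\<theta> = x = \<kappa>\<close>, then both sides are equal. Since \<open>x * \<kappa> ^ (s * t - 1)\<close>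
  stands for the block size, this determines the exponent of \<open>n\<close> in the bound on \<open>k\<close>.\<close>

lemma power_balance:
  fixes x \<kappa> \<theta> :: real
  assumes "1 \<le> \<theta>" "\<theta> \<le> x" "\<theta> \<le> \<kappa>" and ab: "1 \<le> a" "a \<le> s" "1 \<le> b" "b \<le> t"
  shows "(x * \<theta> ^ (s - 1)) ^ (a * b - 1) \<le> (x * \<kappa> ^ (s * t - 1)) ^ (a - 1) * (x ^ s) ^ (b - 1)"
proof -
  obtain a' where a: "a = Suc a'" using ab by (cases a) auto
  obtain b' where b: "b = Suc b'" using ab by (cases b) auto
  obtain r where s: "s = Suc (a' + r)" using ab a by (metis Suc_leD add_Suc le_iff_add)
  obtain q where t: "t = Suc (b' + q)" using ab b by (metis Suc_leD add_Suc le_iff_add)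
  define e where "e = a' * b' + a' + b'"
  have e1: "a * b - 1 = e" "s - 1 = a' + r" by (auto simp: a b s e_def)
  \<comment> \<open>The exponent of \<open>\<theta>\<close> is split into a part to be bounded
    through \<open>\<kappa>\<close> and a part to be bounded through \<open>x\<close>. For
    \<open>r = q = 0\<close> this is an equality.\<close>
  have e2: "(s - 1) * e \<le> (s * t - 1) * a' + r * b'"
    unfolding s t e_def by (simp add: algebra_simps)
  have x0: "1 \<le> x" using assms by linarith
  have "(x * \<theta> ^ (s - 1)) ^ (a * b - 1) = x ^ e * \<theta> ^ ((s - 1) * e)"
    unfolding e1(1) by (simp only: power_mult_distrib power_mult)
  also have "\<dots> \<le> x ^ e * \<theta> ^ ((s * t - 1) * a' + r * b')"
    using e2 assms x0 by (intro mult_left_mono power_increasing) auto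
  also have "\<dots> = x ^ e * ((\<theta> ^ (s * t - 1)) ^ a' * (\<theta> ^ r) ^ b')"
    by (simp add: power_add power_mult)
  also have "\<dots> \<le> x ^ e * ((\<kappa> ^ (s * t - 1)) ^ a' * (x ^ r) ^ b')"
    using assms x0 by (intro mult_left_mono mult_mono power_mono) auto
  also have "\<dots> = (\<kappa> ^ (s * t - 1)) ^ a' * x ^ (e + r * b')"
    by (simp add: power_add power_mult)
  also have "e + r * b' = a' + s * b'" by (simp add: e_def s algebra_simps)
  also have "(\<kappa> ^ (s * t - 1)) ^ a' * x ^ (a' + s * b')
      = (x * \<kappa> ^ (s * t - 1)) ^ (a - 1) * (x ^ s) ^ (b - 1)"
    by (simp add: a b power_add power_mult power_mult_distrib)
  finally show ?thesis .
qed

text \<open>The weight on sets is the image of \<open>w\<close> under \<open>g\<close>. Grouping by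
  the value of \<open>g\<close> adds up the weights of elements with the same image, so
  \<open>g\<close> may fail to be injective.\<close>

lemma codeg_pushforward:
  assumes "finite E" "finite \<P>" "\<And>p. p \<in> \<P> \<Longrightarrow> w p \<noteq> 0 \<Longrightarrow> g p \<subseteq> E"
  shows "codeg E (\<lambda>D. \<Sum>p\<in>{p \<in> \<P>. w p \<noteq> 0 \<and> g p = D}. w p) \<sigma> = (\<Sum>p\<in>{p \<in> \<P>. \<sigma> \<subseteq> g p}. w p)"
proof -
  let ?S = "{p \<in> \<P>. w p \<noteq> 0 \<and> \<sigma> \<subseteq> g p}"
  have "codeg E (\<lambda>D. \<Sum>p\<in>{p \<in> \<P>. w p \<noteq> 0 \<and> g p = D}. w p) \<sigma>
      = (\<Sum>D\<in>{D \<in> Pow E. \<sigma> \<subseteq> D}. \<Sum>p\<in>{p \<in> ?S. g p = D}. w p)"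
    unfolding codeg_def by (intro sum.cong refl arg_cong2[where f = sum]) auto
  also have "\<dots> = (\<Sum>p\<in>?S. w p)" using assms by (intro sum.group) auto
  also have "\<dots> = (\<Sum>p\<in>{p \<in> \<P>. \<sigma> \<subseteq> g p}. w p)"
    using assms(2) by (intro sum.mono_neutral_left) auto
  finally show ?thesis .
qed

text \<open>The hypotheses of \<open>balanced_bipartite_copies\<close>, for the largest
  \<open>D\<close> with \<open>2 * n * D \<le> f\<close>. The threshold \<open>L\<close> has the
  order \<open>x ^ s\<close> of the average number of blocks above an \<open>s\<close>-set. The
  exponent \<open>2 - 1 / s\<close> enters through \<open>n * \<beta> ^ s = n ^ s * \<beta>\<close>,
  where \<open>\<beta>\<close> is \<open>n powr (1 - 1 / s)\<close>; the bound
  \<open>8 * s * t \<le> x\<close> pays for rounding \<open>D\<close> down.\<close>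

lemma large_part_sizes:
  fixes s t n m f :: nat and x :: real
  defines "D \<equiv> f div (2 * n)" and "L \<equiv> (x / (8 * real s)) ^ s"
  assumes st: "1 \<le> s" "1 \<le> t" and n: "1 \<le> n" and x: "8 * real s * real t \<le> x"
    and m: "real m = x * real n powr (2 - 1 / real s)" and f: "m \<le> 2 * f"
  shows "s \<le> D" "x * real n powr (1 - 1 / real s) / 8 \<le> D" "real t \<le> L"
    "4 * real s ^ s * real n ^ s * L \<le> real f * real D ^ (s - 1)"
proof -
  define \<beta> where "\<beta> = real n powr (1 - 1 / real s)"
  have n1: "1 \<le> real n" using n by simp
  have s1: "1 \<le> real s" "1 \<le> real t" using st by auto
  have \<beta>1: "1 \<le> \<beta>" unfolding \<beta>_def using n1 s1 by (intro ge_one_powr_ge_zero) auto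
  have "1 * 1 \<le> real s * real t" using s1 by (intro mult_mono) auto
  then have st1: "1 \<le> real s * real t" by simp
  have x1: "8 * (real s * real t) \<le> x" using x by simp
  then have x0: "0 < x" using st1 by linarith
  have n\<beta>: "real n powr (2 - 1 / real s) = real n * \<beta>"
    using n1 powr_add[of "real n" 1 "1 - 1 / real s"] by (simp add: \<beta>_def)
  have m2: "x * (real n * \<beta>) \<le> 2 * real f" using m f n\<beta> by (metis of_nat_le_iff of_nat_mult of_nat_numeral)
  have "x * \<beta> / 4 \<le> real f / (2 * real n)"
    using m2 n1 by (simp add: field_simps)
  also have "\<dots> \<le> real D + 1"
  proof -
    have "f \<le> (D + 1) * (2 * n)"
      using dividend_less_div_times[of "2 * n" f] n by (simp add: D_def algebra_simps)
    then have "real f \<le> real ((D + 1) * (2 * n))" by (rule of_nat_mono)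
    then have "real f \<le> (real D + 1) * (2 * real n)" unfolding of_nat_mult of_nat_add by simp
    then show ?thesis using n1 by (simp add: pos_divide_le_eq)
  qed
  finally have z: "x * \<beta> / 4 \<le> real D + 1" .
  have "x * 1 \<le> x * \<beta>" using \<beta>1 x0 by (intro mult_left_mono) auto
  then have x\<beta>: "8 * (real s * real t) \<le> x * \<beta>" using x1 by linarith
  have "real s * 1 \<le> real s * real t" using s1 by (intro mult_left_mono) auto
  then have "real s \<le> real D" using z x\<beta> s1 by linarith
  then show "s \<le> D" by simp
  have D8: "x * \<beta> / 8 \<le> D" using z x\<beta> st1 by linarith
  then show "x * real n powr (1 - 1 / real s) / 8 \<le> D" by (simp add: \<beta>_def)
  have "real t \<le> x / (8 * real s)" using x s1 by (simp add: field_simps)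
  also have "\<dots> \<le> L" unfolding L_def
    by (intro self_le_power) (use calculation s1 st in linarith)+
  finally show "real t \<le> L" .
  have n\<beta>s: "real n * \<beta> * \<beta> ^ (s - 1) = real n ^ s"
  proof -
    have "\<beta> * \<beta> ^ (s - 1) = \<beta> ^ s" using st by (simp add: power_eq_if)
    also have "\<dots> = real n powr ((1 - 1 / real s) * real s)"
      using n1 by (simp add: \<beta>_def powr_power mult.commute)
    also have "(1 - 1 / real s) * real s = real (s - 1)" using s1 st by (simp add: field_simps of_nat_diff)
    also have "real n powr real (s - 1) = real n ^ (s - 1)" using n1 by (simp add: powr_realpow)
    finally show ?thesis using st by (simp add: power_eq_if mult.assoc)
  qed
  have "4 * real s ^ s * real n ^ s * L = 4 * real n ^ s * x ^ s / 8 ^ s"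
    using s1 by (simp add: L_def power_divide power_mult_distrib)
  also have "\<dots> = x * (real n * \<beta>) / 2 * (x * \<beta> / 8) ^ (s - 1)"
  proof -
    have "x ^ s = x * x ^ (s - 1)" "(8::real) ^ s = 8 * 8 ^ (s - 1)" using st by (simp_all add: power_eq_if)
    then show ?thesis by (simp add: n\<beta>s[symmetric] power_divide power_mult_distrib)
  qed
  also have "\<dots> \<le> real f * real D ^ (s - 1)"
    using m2 D8 x0 \<beta>1 n1 by (intro mult_mono power_mono) auto
  finally show "4 * real s ^ s * real n ^ s * L \<le> real f * real D ^ (s - 1)" .
qed

text \<open>Here \<open>j\<close> edges span \<open>a\<close> and \<open>b\<close> vertices on the
  two sides, so \<open>j \<le> a * b\<close>, and \<open>power_balance\<close> is used with
  \<open>\<theta> = min x \<kappa>\<close>. The factors \<open>8 ^ s\<close> and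
  \<open>(8 * s) ^ (s * t)\<close> dominate the powers of the constants in \<open>D\<close> and
  \<open>L\<close>; 4 turns into 8 since \<open>f\<close> may be only half of
  \<open>m\<close>.\<close>

lemma balanced_bound:
  fixes x \<kappa> L :: real and f m D :: nat
  assumes st: "1 \<le> s" "1 \<le> t" and \<lambda>: "1 \<le> x" "1 \<le> \<kappa>" and f: "m \<le> 2 * f" "0 < m"
    and D: "x * \<kappa> ^ (s * t - 1) / 8 \<le> D" and L: "L = (x / (8 * real s)) ^ s"
    and ab: "1 \<le> a" "a \<le> s" "1 \<le> b" "b \<le> t" and j: "j \<le> a * b"
    and \<tau>: "\<tau> = 1 / (x * min x \<kappa> ^ (s - 1))"
  shows "4 * real s ^ s * real t ^ t / (real f * real D ^ (a - 1) * L ^ (b - 1))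
    \<le> 8 * real s ^ s * real t ^ t * 8 ^ s * (8 * real s) ^ (s * t) * \<tau> ^ (j - 1) / real m"
proof -
  define \<Lambda> where "\<Lambda> = x * min x \<kappa> ^ (s - 1)"
  have s1: "1 \<le> real s" using st by simp
  have "1 * 1 \<le> x * min x \<kappa> ^ (s - 1)" using \<lambda> by (intro mult_mono one_le_power) auto
  then have \<Lambda>: "1 \<le> \<Lambda>" by (simp add: \<Lambda>_def)
  define \<gamma> where "\<gamma> = x * \<kappa> ^ (s * t - 1)"
  have \<gamma>0: "0 \<le> \<gamma>" using \<lambda> by (simp add: \<gamma>_def)
  have "\<gamma> ^ (a - 1) / 8 ^ s \<le> (\<gamma> / 8) ^ (a - 1)"
  proof -
    have "\<gamma> ^ (a - 1) / 8 ^ s \<le> \<gamma> ^ (a - 1) / 8 ^ (a - 1)"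
      using ab \<gamma>0 by (intro divide_left_mono power_increasing) auto
    then show ?thesis by (simp add: power_divide)
  qed
  also have "\<dots> \<le> real D ^ (a - 1)" using D \<gamma>0 unfolding \<gamma>_def by (intro power_mono) auto
  finally have D': "\<gamma> ^ (a - 1) / 8 ^ s \<le> real D ^ (a - 1)" .
  have L': "(x ^ s) ^ (b - 1) / (8 * real s) ^ (s * t) \<le> L ^ (b - 1)"
  proof -
    have "(x ^ s) ^ (b - 1) / (8 * real s) ^ (s * t) \<le> (x ^ s) ^ (b - 1) / (8 * real s) ^ (s * (b - 1))"
      using ab s1 \<lambda> by (intro divide_left_mono power_increasing mult_le_mono) auto
    then show ?thesis by (simp add: L power_divide power_mult)
  qed
  have "\<Lambda> ^ (j - 1) \<le> \<Lambda> ^ (a * b - 1)" using \<Lambda> j by (intro power_increasing) auto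
  also have "\<dots> \<le> \<gamma> ^ (a - 1) * (x ^ s) ^ (b - 1)"
    unfolding \<Lambda>_def \<gamma>_def using \<lambda> ab by (intro power_balance) auto
  finally have \<Lambda>j: "\<Lambda> ^ (j - 1) \<le> \<gamma> ^ (a - 1) * (x ^ s) ^ (b - 1)" .
  define G where "G = 8 ^ s * (8 * real s) ^ (s * t)"
  have G0: "0 < G" using s1 by (simp add: G_def)
  have "\<Lambda> ^ (j - 1) / G \<le> \<gamma> ^ (a - 1) * (x ^ s) ^ (b - 1) / G"
    using \<Lambda>j G0 by (intro divide_right_mono) auto
  also have "\<dots> = (\<gamma> ^ (a - 1) / 8 ^ s) * ((x ^ s) ^ (b - 1) / (8 * real s) ^ (s * t))"
    by (simp add: G_def)
  also have "\<dots> \<le> real D ^ (a - 1) * L ^ (b - 1)"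
    using D' L' \<lambda> by (intro mult_mono) auto
  finally have DL: "\<Lambda> ^ (j - 1) / G \<le> real D ^ (a - 1) * L ^ (b - 1)" .
  have f2: "real m / 2 \<le> real f" using f by linarith
  have "real m / 2 * (\<Lambda> ^ (j - 1) / G) \<le> real f * (real D ^ (a - 1) * L ^ (b - 1))"
    using f2 DL \<Lambda> G0 by (intro mult_mono) auto
  then have "4 * real s ^ s * real t ^ t / (real f * (real D ^ (a - 1) * L ^ (b - 1)))
      \<le> 4 * real s ^ s * real t ^ t / (real m / 2 * (\<Lambda> ^ (j - 1) / G))"
    using \<Lambda> G0 f(2) by (intro frac_le) auto
  also have "\<dots> = 8 * real s ^ s * real t ^ t * G * \<tau> ^ (j - 1) / real m"
    unfolding \<tau> \<Lambda>_def[symmetric] by (simp add: power_divide mult_ac)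
  finally show ?thesis by (simp add: G_def mult.assoc)
qed

text \<open>A cut with at least half of the edges leads to the bipartite case, and the weight on
  pairs \<open>(S, T)\<close> is carried over to their edge sets. The description of the hyperedges
  is kept because it makes every \<open>K_free\<close> edge set independent.\<close>

theorem balanced_supersaturation:
  fixes s t n :: nat and x \<kappa> \<tau> :: real
  assumes st: "1 \<le> s" "1 \<le> t" and n: "1 \<le> n" and E: "E \<subseteq> pairs_on {1..n}"
    and x: "real (card E) = x * real n powr (2 - 1 / real s)" "8 * real s * real t \<le> x"
    and \<kappa>: "1 \<le> \<kappa>" "\<kappa> ^ (s * t - 1) = real n powr (1 - 1 / real s)"
    and \<tau>: "\<tau> = 1 / (x * min x \<kappa> ^ (s - 1))"
  shows "\<exists>\<mu>. spread E (s * t) (8 * real s ^ s * real t ^ t * 8 ^ s * (8 * real s) ^ (s * t)) \<tau> \<mu> \<and>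
     1 \<le> codeg E \<mu> {} \<and>
     (\<forall>D. \<mu> D \<noteq> 0 \<longrightarrow> (\<exists>S T. S \<subseteq> {1..n} \<and> T \<subseteq> {1..n} \<and> card S = s \<and> card T = t \<and>
        S \<inter> T = {} \<and> D = bipartite_edges (S, T)))"
proof -
  have finE: "finite E" by (rule finite_subset[of _ "Pow {1..n}"]) (use E in auto)
  obtain A where A: "A \<subseteq> {1..n}" "card E \<le> 2 * card {e \<in> E. card (e \<inter> A) = 1}"
    using exists_large_cut[OF _ E] by auto
  define \<phi> :: "nat \<times> nat \<Rightarrow> nat set" where "\<phi> = (\<lambda>(x, y). {x, y})"
  define F where "F = {(x, y). x \<in> A \<and> y \<in> {1..n} - A \<and> {x, y} \<in> E}"
  have FA: "F \<subseteq> A \<times> ({1..n} - A)" by (auto simp: F_def)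
  have finF: "finite F" by (rule finite_subset[OF FA]) (use A finite_subset in auto)
  have "{e \<in> E. card (e \<inter> A) = 1} \<subseteq> \<phi> ` F"
  proof
    fix e assume e: "e \<in> {e \<in> E. card (e \<inter> A) = 1}"
    then obtain u where u: "e \<inter> A = {u}" by (auto simp: card_1_singleton_iff)
    have "card e = 2" "e \<subseteq> {1..n}" using e E by auto
    moreover have "u \<in> e" using u by auto
    ultimately obtain v where v: "e = {u, v}" "v \<noteq> u"
      by (metis card_2_iff insert_commute insert_iff singletonD)
    then have "(u, v) \<in> F" using u e \<open>e \<subseteq> {1..n}\<close> by (auto simp: F_def)
    then show "e \<in> \<phi> ` F" using v by (force simp: \<phi>_def)
  qed
  then have "card {e \<in> E. card (e \<inter> A) = 1} \<le> card F"
    using finF by (meson card_image_le card_mono finite_imageI le_trans)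
  then have EF: "card E \<le> 2 * card F" using A(2) by linarith
  \<comment> \<open>A crossing edge determines its orientation from \<open>A\<close> to the
    complement, so sets of edges and sets of ordered pairs can be exchanged.\<close>
  have inj: "p = q" if "p \<in> A \<times> ({1..n} - A)" "q \<in> A \<times> ({1..n} - A)" "\<phi> p = \<phi> q" for p q
    using that by (auto simp: \<phi>_def doubleton_eq_iff)
  define D where "D = card F div (2 * n)"
  define L where "L = (x / (8 * real s)) ^ s"
  note large = large_part_sizes[OF st n x(2) x(1) EF, folded D_def L_def]
  have "1 \<le> real s * real t" using st mult_mono[of 1 "real s" 1 "real t"] by simp
  then have x1: "1 \<le> x" using x(2) by linarith
  then have "0 < x * real n powr (2 - 1 / real s)" using n by (intro mult_pos_pos) auto
  then have E0: "0 < card E" using x(1) by (metis of_nat_0_less_iff)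
  have F0: "F \<noteq> {}" using E0 EF by auto
  have cA: "card A \<le> n" "card ({1..n} - A) \<le> n"
    using A(1) card_mono[of "{1..n}" A] card_mono[of "{1..n}" "{1..n} - A"] by auto
  have finA: "finite A" using A(1) finite_subset by auto
  have "2 * n * D \<le> card F" by (simp add: D_def mult.commute)
  from balanced_bipartite_copies[OF finA _ FA cA st(1) large(1) st(2) large(3) F0 this large(4)]
  obtain w where w: "\<And>p. 0 \<le> w p"
    "\<And>S T. w (S, T) \<noteq> 0 \<Longrightarrow> S \<times> T \<subseteq> F \<and> card S = s \<and> card T = t"
    "(\<Sum>p\<in>Pow A \<times> Pow ({1..n} - A). w p) = 1"
    "\<And>R. R \<subseteq> F \<Longrightarrow> R \<noteq> {} \<Longrightarrow>
      (\<Sum>p\<in>{p \<in> Pow A \<times> Pow ({1..n} - A). R \<subseteq> fst p \<times> snd p}. w p)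
       \<le> 4 * real s ^ s * real t ^ t /
          (real (card F) * real D ^ (card (fst ` R) - 1) * L ^ (card (snd ` R) - 1))"
    by auto
  define \<P> where "\<P> = Pow A \<times> Pow ({1..n} - A)"
  have fin\<P>: "finite \<P>" using finA by (simp add: \<P>_def)
  define \<mu> where "\<mu> = (\<lambda>D. \<Sum>p\<in>{p \<in> \<P>. w p \<noteq> 0 \<and> bipartite_edges p = D}. w p)"
  have be: "bipartite_edges p = \<phi> ` (fst p \<times> snd p)" for p
    by (simp add: bipartite_edges_def \<phi>_def)
  have sub: "fst p \<times> snd p \<subseteq> F" "card (fst p) = s" "card (snd p) = t" if "w p \<noteq> 0" for p
    using w(2)[of "fst p" "snd p"] that by auto
  have subE: "bipartite_edges p \<subseteq> E" if "w p \<noteq> 0" for p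
    using sub(1)[OF that] unfolding be by (auto simp: F_def \<phi>_def)
  have codeg\<mu>: "codeg E \<mu> \<sigma> = (\<Sum>p\<in>{p \<in> \<P>. \<sigma> \<subseteq> bipartite_edges p}. w p)" for \<sigma>
    unfolding \<mu>_def by (rule codeg_pushforward[OF finE fin\<P> subE])
  have supp: "\<exists>p\<in>\<P>. w p \<noteq> 0 \<and> bipartite_edges p = D" if "\<mu> D \<noteq> 0" for D
    using that unfolding \<mu>_def by (metis (mono_tags, lifting) empty_Collect_eq sum.empty)
  have cardB: "card (bipartite_edges p) = s * t" if "w p \<noteq> 0" for p
  proof -
    have "inj_on \<phi> (fst p \<times> snd p)" using sub(1)[OF that] FA inj by (meson inj_onI subsetD)
    then show ?thesis unfolding be by (simp add: card_image sub[OF that] card_cartesian_product)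
  qed
  show ?thesis
  proof (intro exI[of _ \<mu>] conjI allI impI)
    show "spread E (s * t) (8 * real s ^ s * real t ^ t * 8 ^ s * (8 * real s) ^ (s * t)) \<tau> \<mu>"
      unfolding spread_def
    proof (intro conjI allI impI)
      fix D show "0 \<le> \<mu> D" unfolding \<mu>_def using w(1) by (intro sum_nonneg) auto
    next
      fix D assume "\<mu> D \<noteq> 0"
      then show "D \<subseteq> E" "card D = s * t" using supp[of D] subE cardB by auto
    next
      fix \<sigma> assume \<sigma>: "\<sigma> \<noteq> {}" "\<sigma> \<subseteq> E"
      define rhs where "rhs = 8 * real s ^ s * real t ^ t * 8 ^ s * (8 * real s) ^ (s * t) *
         \<tau> ^ (card \<sigma> - 1) / real (card E)"
      have rhs0: "0 \<le> rhs" unfolding rhs_def \<tau> using x1 \<kappa>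
        by (intro divide_nonneg_nonneg mult_nonneg_nonneg zero_le_power) auto
      have "codeg E \<mu> \<sigma> \<le> rhs"
      \<comment> \<open>Only a \<open>\<sigma>\<close> inside some copy is known to meet at most
        \<open>s\<close> and \<open>t\<close> vertices of the two sides, which the comparison of
        exponents requires.\<close>
      proof (cases "\<exists>p\<in>\<P>. w p \<noteq> 0 \<and> \<sigma> \<subseteq> bipartite_edges p")
        case False
        then have "codeg E \<mu> \<sigma> = 0" unfolding codeg\<mu> by (intro sum.neutral) auto
        then show ?thesis using rhs0 by simp
      next
        case True
        then obtain p where p: "p \<in> \<P>" "w p \<noteq> 0" "\<sigma> \<subseteq> \<phi> ` (fst p \<times> snd p)"
          unfolding be by auto
        define R where "R = {z \<in> F. \<phi> z \<in> \<sigma>}"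
        have RF: "R \<subseteq> F" by (auto simp: R_def)
        have "\<sigma> \<subseteq> \<phi> ` F" using p(3) sub(1)[OF p(2)] by blast
        then have \<sigma>R: "\<sigma> = \<phi> ` R" unfolding R_def by blast
        then have Rne: "R \<noteq> {}" using \<sigma> by auto
        have finR: "finite R" using RF finF finite_subset by auto
        have Rsub: "R \<subseteq> fst q \<times> snd q" if "q \<in> \<P>" "\<sigma> \<subseteq> bipartite_edges q" for q
        proof
          fix z assume z: "z \<in> R"
          then have "\<phi> z \<in> \<phi> ` (fst q \<times> snd q)" using that \<sigma>R unfolding be by auto
          then obtain z' where z': "z' \<in> fst q \<times> snd q" "\<phi> z = \<phi> z'" by auto
          have "z' \<in> A \<times> ({1..n} - A)" using z' that by (auto simp: \<P>_def)
          then have "z = z'" using inj z' z RF FA by blast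
          then show "z \<in> fst q \<times> snd q" using z' by simp
        qed
        have "codeg E \<mu> \<sigma> \<le> (\<Sum>q\<in>{q \<in> \<P>. R \<subseteq> fst q \<times> snd q}. w q)"
          unfolding codeg\<mu> using Rsub fin\<P> w(1) by (intro sum_mono2) auto
        also have "\<dots> \<le> 4 * real s ^ s * real t ^ t /
          (real (card F) * real D ^ (card (fst ` R) - 1) * L ^ (card (snd ` R) - 1))"
          using w(4)[OF RF Rne] unfolding \<P>_def .
        also have "\<dots> \<le> rhs" unfolding rhs_def
        proof (rule balanced_bound[OF st x1 \<kappa>(1) EF E0 _ L_def _ _ _ _ _ \<tau>])
          show "x * \<kappa> ^ (s * t - 1) / 8 \<le> D" using large(2) \<kappa>(2) by simp
          show "1 \<le> card (fst ` R)" "1 \<le> card (snd ` R)"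
            using finR Rne by (auto simp: Suc_le_eq card_gt_0_iff)
          have "R \<subseteq> fst p \<times> snd p" using Rsub p unfolding be by auto
          then have "fst ` R \<subseteq> fst p" "snd ` R \<subseteq> snd p" by auto
          moreover have "finite (fst p)" "finite (snd p)"
            using sub[OF p(2)] st by (auto intro: card_ge_0_finite)
          ultimately show "card (fst ` R) \<le> s" "card (snd ` R) \<le> t"
            using sub(2,3)[OF p(2)] by (metis card_mono)+
          have "card \<sigma> \<le> card R" using \<sigma>R finR by (simp add: card_image_le)
          also have "\<dots> \<le> card (fst ` R \<times> snd ` R)"
            using finR subset_fst_snd by (intro card_mono) auto
          finally show "card \<sigma> \<le> card (fst ` R) * card (snd ` R)" by (simp add: card_cartesian_product)
        qed
        finally show ?thesis .
      qed
      then show "codeg E \<mu> \<sigma> \<le> 8 * real s ^ s * real t ^ t * 8 ^ s * (8 * real s) ^ (s * t) *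
         \<tau> ^ (card \<sigma> - 1) / real (card E)" by (simp add: rhs_def)
    qed
    show "1 \<le> codeg E \<mu> {}" using w(3) by (simp add: codeg\<mu> \<P>_def)
  next
    fix D' assume "\<mu> D' \<noteq> 0"
    then obtain p where p: "p \<in> \<P>" "w p \<noteq> 0" "bipartite_edges p = D'" using supp by blast
    then have "fst p \<subseteq> A" "snd p \<subseteq> {1..n} - A" by (auto simp: \<P>_def)
    then have "fst p \<subseteq> {1..n}" "snd p \<subseteq> {1..n}" "fst p \<inter> snd p = {}" using A(1) by auto
    then show "\<exists>S T. S \<subseteq> {1..n} \<and> T \<subseteq> {1..n} \<and> card S = s \<and> card T = t \<and>
        S \<inter> T = {} \<and> D' = bipartite_edges (S, T)"
      using sub(2,3)[OF p(2)] p(3) by (metis prod.collapse)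
  qed
qed

subsection \<open>Iterating the container step\<close>

lemma K_free_no_bipartite_edges:
  assumes "K_free s t (V, I)" "finite S" "finite T" "S \<subseteq> V" "T \<subseteq> V"
    "card S = s" "card T = t" "S \<inter> T = {}"
  shows "\<not> bipartite_edges (S, T) \<subseteq> I"
proof
  assume sub: "bipartite_edges (S, T) \<subseteq> I"
  obtain g where g: "bij_betw g {..<s} S"
    using assms(2,6) by (metis atLeast0LessThan ex_bij_betw_nat_finite)
  obtain h where h: "bij_betw h {..<t} T"
    using assms(3,7) by (metis atLeast0LessThan ex_bij_betw_nat_finite)
  have gS: "g i \<in> S" if "i < s" for i using g that by (auto simp: bij_betw_def)
  have hT: "h j \<in> T" if "j < t" for j using h that by (auto simp: bij_betw_def)
  have "inj_on (case_sum g h) ({..<s} <+> {..<t})"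
  proof (rule inj_onI)
    fix u v assume uv: "u \<in> {..<s} <+> {..<t}" "v \<in> {..<s} <+> {..<t}"
      "case_sum g h u = case_sum g h v"
    have inj: "inj_on g {..<s}" "inj_on h {..<t}" using g h by (auto simp: bij_betw_def)
    have ne: "g i \<noteq> h j" if "i < s" "j < t" for i j
      using gS[OF that(1)] hT[OF that(2)] assms(8) by auto
    show "u = v"
      using uv inj ne by (cases u; cases v) (force dest: inj_onD)+
  qed
  moreover have "case_sum g h ` ({..<s} <+> {..<t}) \<subseteq> V"
    using gS hT assms(4,5) by auto
  moreover have "case_sum g h ` e \<in> I" if he: "e \<in> {{Inl i, Inr j} | i j. i < s \<and> j < t}" for e
  proof -
    obtain i j where e: "e = {Inl i, Inr j}" "i < s" "j < t" using he by blast
    then have "{g i, h j} \<in> bipartite_edges (S, T)"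
      using gS hT by (force simp: bipartite_edges_def)
    then show ?thesis using e sub by auto
  qed
  ultimately have "contains_copy (V, I) (complete_bipartite s t)"
    unfolding contains_copy_def complete_bipartite_def by auto
  then show False using assms(1) by (simp add: K_free_def)
qed

text \<open>For the \<open>\<tau>\<close> of \<open>balanced_supersaturation\<close>, the product
  \<open>card E * \<tau>\<close> is \<open>n powr (2 - 1 / s) / min x \<kappa> ^ (s - 1)\<close>,
  and \<open>ln (1 / \<tau>)\<close> is at most \<open>s * ln x\<close>; the constant takes up the
  factor \<open>s\<close>.\<close>

lemma graph_container_step:
  fixes s t :: nat
  assumes st: "2 \<le> s" "1 \<le> t"
  obtains c Q :: real where "0 < c" "c < 1" "0 < Q"
    "\<And>n E x \<kappa>. 1 \<le> n \<Longrightarrow> E \<subseteq> pairs_on {1..n} \<Longrightarrow>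
     real (card E) = x * real n powr (2 - 1 / real s) \<Longrightarrow> 8 * real s * real t \<le> x \<Longrightarrow>
     1 \<le> \<kappa> \<Longrightarrow> \<kappa> ^ (s * t - 1) = real n powr (1 - 1 / real s) \<Longrightarrow>
     \<exists>\<C>. \<C> \<subseteq> Pow E \<and>
        real (card \<C>) \<le> exp (Q * (real n powr (2 - 1 / real s) * ln x / min x \<kappa> ^ (s - 1))) \<and>
        (\<forall>C\<in>\<C>. real (card C) \<le> (1 - c) * real (card E)) \<and>
        (\<forall>I\<subseteq>E. K_free s t ({1..n}, I) \<longrightarrow> (\<exists>C\<in>\<C>. I \<subseteq> C))"
proof -
  define K where "K = 8 * real s ^ s * real t ^ t * 8 ^ s * (8 * real s) ^ (s * t)"
  have s1: "1 \<le> real s" "1 \<le> real t" using st by auto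
  have "1 * 1 * 1 * 1 * 1 \<le> K" unfolding K_def using s1
    by (intro mult_mono one_le_power) auto
  then have K: "1 \<le> K" by simp
  have s_pos: "1 \<le> s" using st by simp
  have rst: "1 \<le> s * t" using st by simp
  from container_step[OF rst K, where 'a = "nat set"] obtain c Q where cQ: "0 < c" "c < 1" "0 < Q" and
    step: "\<And>V \<mu> \<tau>. finite V \<Longrightarrow> V \<noteq> {} \<Longrightarrow> 0 < \<tau> \<Longrightarrow> \<tau> \<le> exp (- 1) \<Longrightarrow>
     1 \<le> real (card V) * \<tau> \<Longrightarrow> spread V (s * t) K \<tau> \<mu> \<Longrightarrow> 1 \<le> codeg V \<mu> {} \<Longrightarrow>
     (\<exists>\<C>. \<C> \<subseteq> Pow V \<and> real (card \<C>) \<le> exp (Q * (real (card V) * \<tau> * ln (1 / \<tau>))) \<and>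
        (\<forall>C\<in>\<C>. real (card C) \<le> (1 - c) * real (card V)) \<and>
        (\<forall>I\<subseteq>V. indep_set \<mu> I \<longrightarrow> (\<exists>C\<in>\<C>. (I :: nat set set) \<subseteq> C)))"
    by metis
  show ?thesis
  proof (rule that[of c "Q * s"])
    fix n :: nat and E :: "nat set set" and x \<kappa> :: real
    assume n: "1 \<le> n" and E: "E \<subseteq> pairs_on {1..n}"
      and x: "real (card E) = x * real n powr (2 - 1 / real s)" "8 * real s * real t \<le> x"
      and \<kappa>: "1 \<le> \<kappa>" "\<kappa> ^ (s * t - 1) = real n powr (1 - 1 / real s)"
    define l where "l = min x \<kappa>"
    define \<tau> where "\<tau> = 1 / (x * l ^ (s - 1))"
    define N where "N = real n powr (2 - 1 / real s)"
    have "1 * 1 \<le> real s * real t" using s1 by (intro mult_mono) auto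
    then have x8: "8 \<le> x" using x(2) by linarith
    have l: "1 \<le> l" "l \<le> x" using x8 \<kappa> by (auto simp: l_def)
    have N0: "0 < N" using n by (simp add: N_def)
    have E0: "0 < real (card E)" using x(1) x8 N0 by (simp add: N_def)
    have finE: "finite E" by (rule finite_subset[of _ "Pow {1..n}"]) (use E in auto)
    have l1: "1 \<le> l ^ (s - 1)" using l by simp
    have \<tau>0: "0 < \<tau>" using x8 l by (simp add: \<tau>_def)
    have "exp 1 \<le> (3::real)" using exp_le by simp
    then have "exp 1 \<le> x * l ^ (s - 1)" using x8 mult_mono[of 8 x 1 "l ^ (s - 1)"] l1 by linarith
    then have \<tau>e: "\<tau> \<le> exp (- 1)"
      unfolding \<tau>_def exp_minus inverse_eq_divide by (intro divide_left_mono mult_pos_pos) (use x8 l in auto)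
    have m\<tau>: "real (card E) * \<tau> = N / l ^ (s - 1)" using x8 x(1) by (simp add: \<tau>_def N_def)
    \<comment> \<open>\<open>container_step\<close> needs \<open>1 \<le> card E * \<tau>\<close>;
      the minimum in \<open>l\<close> provides it, because a power of \<open>\<kappa>\<close> is
      known in terms of \<open>n\<close>.\<close>
    have "l ^ (s - 1) \<le> \<kappa> ^ (s - 1)" using l by (intro power_mono) (auto simp: l_def)
    also have "\<dots> \<le> \<kappa> ^ (s * t - 1)" using \<kappa>(1) st by (intro power_increasing diff_le_mono) auto
    also have "\<dots> \<le> N" unfolding \<kappa>(2) N_def using n by (intro powr_mono) auto
    finally have m\<tau>1: "1 \<le> real (card E) * \<tau>" unfolding m\<tau> using l1 by simp
    have "\<exists>\<mu>. spread E (s * t) K \<tau> \<mu> \<and> 1 \<le> codeg E \<mu> {} \<and>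
      (\<forall>D. \<mu> D \<noteq> 0 \<longrightarrow> (\<exists>S T. S \<subseteq> {1..n} \<and> T \<subseteq> {1..n} \<and> card S = s \<and> card T = t \<and>
        S \<inter> T = {} \<and> D = bipartite_edges (S, T)))"
      unfolding K_def by (rule balanced_supersaturation[OF s_pos st(2) n E x \<kappa>])
        (simp add: \<tau>_def l_def)
    then obtain \<mu> where \<mu>: "spread E (s * t) K \<tau> \<mu>" "1 \<le> codeg E \<mu> {}"
      "\<And>D. \<mu> D \<noteq> 0 \<Longrightarrow> \<exists>S T. S \<subseteq> {1..n} \<and> T \<subseteq> {1..n} \<and> card S = s \<and> card T = t \<and>
        S \<inter> T = {} \<and> D = bipartite_edges (S, T)"
      by (elim exE conjE) metis
    have indep: "indep_set \<mu> I" if "K_free s t ({1..n}, I)" for I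
      unfolding indep_set_def
    proof (intro allI impI, rule ccontr)
      fix D assume D: "D \<subseteq> I" "\<mu> D \<noteq> 0"
      from \<mu>(3)[OF D(2)] obtain S T where ST: "S \<subseteq> {1..n}" "T \<subseteq> {1..n}" "card S = s" "card T = t"
        "S \<inter> T = {}" "D = bipartite_edges (S, T)" by (elim exE conjE) (rule that)
      have "finite S" "finite T" using ST(1,2) finite_subset[OF _ finite_atLeastAtMost] by blast+
      from K_free_no_bipartite_edges[OF that this ST(1-5)] show False using D(1) ST(6) by simp
    qed
    have "ln (1 / \<tau>) = ln x + real (s - 1) * ln l"
      using x8 l by (simp add: \<tau>_def ln_mult ln_realpow)
    also have "\<dots> \<le> ln x + real (s - 1) * ln x" using l by (intro add_left_mono mult_left_mono) auto
    also have "\<dots> = real s * ln x" using st by (simp add: of_nat_diff algebra_simps)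
    finally have "Q * (real (card E) * \<tau> * ln (1 / \<tau>)) \<le> Q * (N / l ^ (s - 1) * (real s * ln x))"
      unfolding m\<tau> using cQ N0 l1 by (intro mult_left_mono) auto
    also have "\<dots> = Q * s * (N * ln x / l ^ (s - 1))" by simp
    finally have bound: "exp (Q * (real (card E) * \<tau> * ln (1 / \<tau>))) \<le> exp (Q * s * (N * ln x / l ^ (s - 1)))"
      by simp
    have "E \<noteq> {}" using E0 by auto
    from step[OF finE this \<tau>0 \<tau>e m\<tau>1 \<mu>(1,2)] obtain \<C> where
      \<C>: "\<C> \<subseteq> Pow E" "real (card \<C>) \<le> exp (Q * (real (card E) * \<tau> * ln (1 / \<tau>)))"
        "\<forall>C\<in>\<C>. real (card C) \<le> (1 - c) * real (card E)"
        "\<forall>I\<subseteq>E. indep_set \<mu> I \<longrightarrow> (\<exists>C\<in>\<C>. I \<subseteq> C)" by blast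
    from \<C>(2) bound have "real (card \<C>) \<le> exp (Q * s * (N * ln x / l ^ (s - 1)))" by linarith
    moreover have "\<forall>I\<subseteq>E. K_free s t ({1..n}, I) \<longrightarrow> (\<exists>C\<in>\<C>. I \<subseteq> C)"
      using \<C>(4) indep by blast
    ultimately show "\<exists>\<C>. \<C> \<subseteq> Pow E \<and>
        real (card \<C>) \<le> exp (Q * s * (real n powr (2 - 1 / real s) * ln x / min x \<kappa> ^ (s - 1))) \<and>
        (\<forall>C\<in>\<C>. real (card C) \<le> (1 - c) * real (card E)) \<and>
        (\<forall>I\<subseteq>E. K_free s t ({1..n}, I) \<longrightarrow> (\<exists>C\<in>\<C>. I \<subseteq> C))"
      using \<C>(1,3) unfolding N_def l_def by blast
  qed (use cQ st in auto)
qed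

text \<open>Level \<open>j\<close> is the range from \<open>k * \<theta> ^ j * N\<close> to
  \<open>k * \<theta> ^ Suc j * N\<close> of edge numbers. As \<open>\<theta> = 1 / (1 - c)\<close>,
  one step leaves the level downwards, so each level is charged at most once along a branch and the
  costs of the levels add up in the exponent.\<close>

lemma iterated_containers:
  fixes good :: "'a set \<Rightarrow> bool" and \<theta> k N c :: real and cost :: "nat \<Rightarrow> real"
  assumes W: "finite W" and c: "c < 1" "\<theta> = 1 / (1 - c)" and k: "0 < k" and N: "0 < N"
    and cost: "\<And>j. 0 \<le> cost j"
    and step: "\<And>j E. E \<subseteq> W \<Longrightarrow> k * \<theta> ^ j * N < real (card E) \<Longrightarrow> real (card E) \<le> k * \<theta> ^ Suc j * N \<Longrightarrow>
      \<exists>\<C>. \<C> \<subseteq> Pow E \<and> real (card \<C>) \<le> exp (cost j) \<and>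
        (\<forall>C\<in>\<C>. real (card C) \<le> (1 - c) * real (card E)) \<and> (\<forall>I\<subseteq>E. good I \<longrightarrow> (\<exists>C\<in>\<C>. I \<subseteq> C))"
    and E: "E \<subseteq> W" "real (card E) \<le> k * \<theta> ^ i * N"
  shows "\<exists>\<C>. \<C> \<subseteq> Pow E \<and> real (card \<C>) \<le> exp (\<Sum>j<i. cost j) \<and>
        (\<forall>C\<in>\<C>. real (card C) \<le> k * N) \<and> (\<forall>I\<subseteq>E. good I \<longrightarrow> (\<exists>C\<in>\<C>. I \<subseteq> C))"
  using E
proof (induction i arbitrary: E)
  case 0
  then show ?case by (intro exI[of _ "{E}"]) auto
next
  case (Suc i)
  show ?case
  proof (cases "real (card E) \<le> k * \<theta> ^ i * N")
    case True
    have "exp (\<Sum>j<i. cost j) \<le> exp (\<Sum>j<Suc i. cost j)" using cost[of i] by simp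
    then show ?thesis using Suc.IH[OF Suc.prems(1) True] by (meson order_trans)
  next
    case False
    then obtain \<C> where \<C>: "\<C> \<subseteq> Pow E" "real (card \<C>) \<le> exp (cost i)"
      "\<And>C. C \<in> \<C> \<Longrightarrow> real (card C) \<le> (1 - c) * real (card E)"
      "\<And>I. I \<subseteq> E \<Longrightarrow> good I \<Longrightarrow> \<exists>C\<in>\<C>. I \<subseteq> C"
      using step[OF Suc.prems(1) _ Suc.prems(2)] by force
    have "\<exists>\<D>. \<D> \<subseteq> Pow C \<and> real (card \<D>) \<le> exp (\<Sum>j<i. cost j) \<and>
        (\<forall>C\<in>\<D>. real (card C) \<le> k * N) \<and> (\<forall>I\<subseteq>C. good I \<longrightarrow> (\<exists>C\<in>\<D>. I \<subseteq> C))" if "C \<in> \<C>" for C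
    proof (rule Suc.IH)
      show "C \<subseteq> W" using that \<C>(1) Suc.prems(1) by auto
      have "real (card C) \<le> (1 - c) * (k * \<theta> ^ Suc i * N)"
        using \<C>(3)[OF that] mult_left_mono[OF Suc.prems(2), of "1 - c"] c(1) by linarith
      also have "\<dots> = k * \<theta> ^ i * N" using c by simp
      finally show "real (card C) \<le> k * \<theta> ^ i * N" .
    qed
    then obtain \<D> where \<D>: "\<And>C. C \<in> \<C> \<Longrightarrow> \<D> C \<subseteq> Pow C" "\<And>C. C \<in> \<C> \<Longrightarrow> real (card (\<D> C)) \<le> exp (\<Sum>j<i. cost j)"
      "\<And>C C'. C \<in> \<C> \<Longrightarrow> C' \<in> \<D> C \<Longrightarrow> real (card C') \<le> k * N"
      "\<And>C I. C \<in> \<C> \<Longrightarrow> I \<subseteq> C \<Longrightarrow> good I \<Longrightarrow> \<exists>C'\<in>\<D> C. I \<subseteq> C'"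
      by metis
    have "finite E" using Suc.prems W finite_subset by auto
    then have fin\<C>: "finite \<C>" using \<C>(1) finite_subset by auto
    show ?thesis
    proof (intro exI[of _ "\<Union>C\<in>\<C>. \<D> C"] conjI ballI allI impI)
      have "card (\<Union>C\<in>\<C>. \<D> C) \<le> (\<Sum>C\<in>\<C>. card (\<D> C))" by (rule card_UN_le[OF fin\<C>])
      then have "real (card (\<Union>C\<in>\<C>. \<D> C)) \<le> (\<Sum>C\<in>\<C>. real (card (\<D> C)))"
        by (metis of_nat_le_iff of_nat_sum)
      also have "\<dots> \<le> (\<Sum>C\<in>\<C>. exp (\<Sum>j<i. cost j))" by (intro sum_mono \<D>(2))
      also have "\<dots> = real (card \<C>) * exp (\<Sum>j<i. cost j)" by simp
      also have "\<dots> \<le> exp (cost i) * exp (\<Sum>j<i. cost j)" using \<C>(2) by (intro mult_right_mono) auto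
      finally show "real (card (\<Union>C\<in>\<C>. \<D> C)) \<le> exp (\<Sum>j<Suc i. cost j)"
        by (simp add: exp_add[symmetric] add.commute)
      show "(\<Union>C\<in>\<C>. \<D> C) \<subseteq> Pow E" using \<D>(1) \<C>(1) by blast
    next
      fix C assume "C \<in> (\<Union>C\<in>\<C>. \<D> C)"
      then show "real (card C) \<le> k * N" using \<D>(3) by auto
    next
      fix I assume I: "I \<subseteq> E" "good I"
      then obtain C where "C \<in> \<C>" "I \<subseteq> C" using \<C>(4) by blast
      then show "\<exists>C\<in>\<Union>C\<in>\<C>. \<D> C. I \<subseteq> C" using \<D>(4)[of C I] I by auto
    qed
  qed
qed

section \<open>Total cost over all levels\<close>

text \<open>With \<open>a = k * \<theta> ^ j\<close>, the reciprocal of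
  \<open>min a \<kappa> ^ p\<close> is at most the sum of those of \<open>a ^ p\<close> and
  \<open>\<kappa> ^ p\<close>. The first kind of term decays geometrically against a logarithm
  linear in \<open>j\<close>; in the second, each of the \<open>i\<close> logarithms is replaced by
  the bound for the top level.\<close>

lemma sum_level_costs:
  fixes \<theta> k \<kappa> :: real and p i :: nat
  assumes \<theta>: "1 < \<theta>" and p: "1 \<le> p" and k: "exp 1 \<le> k" and \<kappa>: "1 \<le> \<kappa>"
  shows "(\<Sum>j<i. ln (k * \<theta> ^ Suc j) / min (k * \<theta> ^ j) \<kappa> ^ p)
    \<le> (1 + ln \<theta>) / (1 - 1 / \<theta>)\<^sup>2 * (ln k / k ^ p) + real i * (ln k + real i * ln \<theta>) / \<kappa> ^ p"
proof -
  define z where "z = 1 / \<theta>"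
  have z: "0 < z" "z < 1" using \<theta> by (auto simp: z_def)
  have "0 < exp (1::real)" by simp
  then have k0: "0 < k" using k by linarith
  have lnk: "1 \<le> ln k" using k k0 by (metis ln_exp ln_mono exp_gt_zero)
  have ln\<theta>: "0 < ln \<theta>" using \<theta> by simp
  have ln_eq: "ln (k * \<theta> ^ Suc j) = ln k + real (Suc j) * ln \<theta>" for j
    using k0 \<theta> by (simp add: ln_mult ln_realpow del: power_Suc)
  have level: "ln (k * \<theta> ^ Suc j) / min (k * \<theta> ^ j) \<kappa> ^ p
      \<le> (1 + ln \<theta>) * (ln k / k ^ p) * (real (Suc j) * z ^ j) + (ln k + real i * ln \<theta>) / \<kappa> ^ p"
    if j: "j < i" for j
  proof -
    define a where "a = k * \<theta> ^ j"
    define y where "y = ln (k * \<theta> ^ Suc j)"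
    have a: "0 < a" using k0 \<theta> by (simp add: a_def)
    have y0: "0 \<le> y" unfolding y_def ln_eq using lnk ln\<theta> by simp
    have y1: "y \<le> (1 + ln \<theta>) * ln k * real (Suc j)"
    proof -
      have "1 * 1 \<le> ln k * real (Suc j)" using lnk by (intro mult_mono) auto
      then have "ln \<theta> * real (Suc j) * 1 \<le> ln \<theta> * real (Suc j) * ln k"
        using lnk ln\<theta> by (intro mult_left_mono) auto
      moreover have "ln k * 1 \<le> ln k * real (Suc j)" using lnk by (intro mult_left_mono) auto
      ultimately show ?thesis unfolding y_def ln_eq by (simp add: algebra_simps)
    qed
    have y2: "y \<le> ln k + real i * ln \<theta>"
    proof -
      have "real (Suc j) * ln \<theta> \<le> real i * ln \<theta>" using j ln\<theta> by (intro mult_right_mono) auto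
      then show ?thesis unfolding y_def ln_eq by simp
    qed
    have "k ^ p * \<theta> ^ j \<le> a ^ p"
    proof -
      have "\<theta> ^ j \<le> (\<theta> ^ j) ^ p" using \<theta> p by (intro self_le_power one_le_power) auto
      then show ?thesis using k0 by (simp add: a_def power_mult_distrib)
    qed
    then have "y / a ^ p \<le> (1 + ln \<theta>) * ln k * real (Suc j) / (k ^ p * \<theta> ^ j)"
      using y0 y1 k0 \<theta> by (intro frac_le) auto
    also have "\<dots> = (1 + ln \<theta>) * (ln k / k ^ p) * (real (Suc j) * z ^ j)"
      by (simp add: z_def power_divide)
    finally have 1: "y / a ^ p \<le> (1 + ln \<theta>) * (ln k / k ^ p) * (real (Suc j) * z ^ j)" .
    have 2: "y / \<kappa> ^ p \<le> (ln k + real i * ln \<theta>) / \<kappa> ^ p"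
      using y2 \<kappa> by (intro divide_right_mono) auto
    have "0 \<le> y / a ^ p" "0 \<le> y / \<kappa> ^ p" using y0 a \<kappa> by auto
    then have "y / min a \<kappa> ^ p \<le> y / a ^ p + y / \<kappa> ^ p" by (auto simp: min_def)
    then show ?thesis using 1 2 unfolding y_def[symmetric] a_def[symmetric] by linarith
  qed
  \<comment> \<open>The derivative of the geometric series; the linear factor comes from
    \<open>ln (k * \<theta> ^ Suc j)\<close>.\<close>
  have "(\<lambda>j. real (Suc j) * z ^ j) sums (1 / (1 - z)\<^sup>2)"
    using geometric_deriv_sums[of z] z by simp
  then have geo: "(\<Sum>j<i. real (Suc j) * z ^ j) \<le> 1 / (1 - z)\<^sup>2"
    using z by (metis (no_types, lifting) sums_unique sums_summable sum_le_suminf finite_lessThan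
        mult_nonneg_nonneg of_nat_0_le_iff zero_le_power less_imp_le)
  have "(\<Sum>j<i. ln (k * \<theta> ^ Suc j) / min (k * \<theta> ^ j) \<kappa> ^ p)
     \<le> (\<Sum>j<i. (1 + ln \<theta>) * (ln k / k ^ p) * (real (Suc j) * z ^ j) + (ln k + real i * ln \<theta>) / \<kappa> ^ p)"
    by (intro sum_mono level) auto
  also have "\<dots> = (1 + ln \<theta>) * (ln k / k ^ p) * (\<Sum>j<i. real (Suc j) * z ^ j)
      + real i * (ln k + real i * ln \<theta>) / \<kappa> ^ p"
    by (simp add: sum.distrib sum_distrib_left)
  also have "(1 + ln \<theta>) * (ln k / k ^ p) * (\<Sum>j<i. real (Suc j) * z ^ j)
      \<le> (1 + ln \<theta>) * (ln k / k ^ p) * (1 / (1 - z)\<^sup>2)"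
    using geo ln\<theta> lnk k0
    by (intro mult_left_mono mult_nonneg_nonneg divide_nonneg_nonneg zero_le_power; linarith)
  finally show ?thesis by (simp add: z_def mult_ac)
qed

text \<open>If \<open>k\<close> is at least \<open>n powr (\<rho> / 2)\<close>, the bound on
  \<open>k\<close> absorbs one logarithm and \<open>ln k\<close> is comparable to the other. For
  smaller \<open>k\<close>, \<open>ln k\<close> may be far below \<open>ln n\<close>, but then
  \<open>\<kappa> / k\<close> exceeds a fixed power of \<open>n\<close>, which beats both
  logarithms.\<close>

lemma log_square_absorbed:
  fixes n k \<rho> \<kappa> :: real and p :: nat
  assumes p: "1 \<le> p" and \<rho>: "0 < \<rho>" and n: "exp 1 \<le> n" and k: "exp 1 \<le> k"
    and \<kappa>: "\<kappa> = n powr \<rho>" and le: "k \<le> \<kappa> / ln n powr (1 / real p)"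
  shows "(ln n)\<^sup>2 / \<kappa> ^ p \<le> (2 / \<rho> + (4 / \<rho>)\<^sup>2) * (ln k / k ^ p)"
proof -
  have e0: "0 < exp (1::real)" "1 \<le> exp (1::real)" by auto
  have n0: "1 \<le> n" "1 \<le> k" using n k e0 by linarith+
  have lnn: "1 \<le> ln n" "1 \<le> ln k"
    using n k n0 by (metis ln_exp ln_mono exp_gt_zero)+
  have \<kappa>0: "1 \<le> \<kappa>" unfolding \<kappa> using n0 \<rho> by (intro ge_one_powr_ge_zero) auto
  have kp: "0 < k ^ p" "0 < \<kappa> ^ p" using n0 \<kappa>0 by auto
  show ?thesis
  proof (cases "ln k \<ge> \<rho> / 2 * ln n")
    case True
    have "k * ln n powr (1 / real p) \<le> \<kappa>" using le lnn by (simp add: pos_le_divide_eq)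
    then have "(k * ln n powr (1 / real p)) ^ p \<le> \<kappa> ^ p" using n0 by (intro power_mono) auto
    moreover have "(ln n powr (1 / real p)) ^ p = ln n" using p lnn by (simp add: powr_power)
    ultimately have "k ^ p * ln n \<le> \<kappa> ^ p" by (simp add: power_mult_distrib)
    then have "ln n / \<kappa> ^ p \<le> 1 / k ^ p" using kp by (simp add: field_simps)
    then have "ln n / \<kappa> ^ p * ln n \<le> 1 / k ^ p * (2 / \<rho> * ln k)"
      using True \<rho> lnn kp by (intro mult_mono) (auto simp: field_simps)
    then have "(ln n)\<^sup>2 / \<kappa> ^ p \<le> 2 / \<rho> * (ln k / k ^ p)" by (simp add: power2_eq_square mult_ac)
    moreover have "0 \<le> (4 / \<rho>)\<^sup>2 * (ln k / k ^ p)" using lnn kp by simp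
    ultimately show ?thesis unfolding distrib_right by linarith
  next
    case False
    have "k \<le> n powr (\<rho> / 2)"
    proof -
      have "ln k \<le> ln (n powr (\<rho> / 2))" using False n0 by (simp add: ln_powr)
      then show ?thesis using n0 by (subst (asm) ln_le_cancel_iff) auto
    qed
    \<comment> \<open>Squaring turns \<open>\<rho> / 4\<close> into \<open>\<rho> / 2\<close>, half
      of the exponent of \<open>\<kappa>\<close>; the other half pays for \<open>k\<close>.\<close>
    have "ln n \<le> n powr (\<rho> / 4) / (\<rho> / 4)" using ln_powr_bound[of n "\<rho> / 4"] n0 \<rho> by simp
    then have "(ln n)\<^sup>2 \<le> (n powr (\<rho> / 4) / (\<rho> / 4))\<^sup>2" using lnn by (intro power_mono) auto
    also have "\<dots> = (4 / \<rho>)\<^sup>2 * n powr (\<rho> / 2)"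
      using n0 by (simp add: power_divide power_mult_distrib powr_power)
    finally have l2: "(ln n)\<^sup>2 \<le> (4 / \<rho>)\<^sup>2 * n powr (\<rho> / 2)" .
    have n1: "1 \<le> n powr (\<rho> / 2)" using n0 \<rho> by (intro ge_one_powr_ge_zero) auto
    have \<kappa>2: "\<kappa> = n powr (\<rho> / 2) * n powr (\<rho> / 2)" using n0 by (simp add: \<kappa> powr_add[symmetric])
    have "(ln n)\<^sup>2 * k ^ p \<le> ((4 / \<rho>)\<^sup>2 * n powr (\<rho> / 2)) * (n powr (\<rho> / 2)) ^ p"
      using l2 \<open>k \<le> n powr (\<rho> / 2)\<close> n0 by (intro mult_mono power_mono) auto
    also have "\<dots> \<le> (4 / \<rho>)\<^sup>2 * ((n powr (\<rho> / 2)) ^ p * (n powr (\<rho> / 2)) ^ p)"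
    proof -
      have "n powr (\<rho> / 2) \<le> (n powr (\<rho> / 2)) ^ p" using n1 p by (intro self_le_power) auto
      then show ?thesis by (simp add: mult.assoc mult_left_mono mult_right_mono)
    qed
    also have "\<dots> = (4 / \<rho>)\<^sup>2 * \<kappa> ^ p" by (simp add: \<kappa>2 power_mult_distrib)
    finally have "(ln n)\<^sup>2 * k ^ p \<le> (4 / \<rho>)\<^sup>2 * \<kappa> ^ p" .
    then have "(ln n)\<^sup>2 / \<kappa> ^ p \<le> (4 / \<rho>)\<^sup>2 * (1 / k ^ p)"
      using kp by (simp add: field_simps del: power_divide)
    also have "\<dots> \<le> (4 / \<rho>)\<^sup>2 * (ln k / k ^ p)"
      using lnn kp by (intro mult_left_mono divide_right_mono) auto
    finally have "(ln n)\<^sup>2 / \<kappa> ^ p \<le> (4 / \<rho>)\<^sup>2 * (ln k / k ^ p)" .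
    moreover have "0 \<le> 2 / \<rho> * (ln k / k ^ p)" using lnn kp \<rho> by simp
    ultimately show ?thesis unfolding distrib_right by linarith
  qed
qed

theorem theorem7p6:
  fixes s t :: nat
  assumes "2 \<le> s" and "s \<le> t"
  shows "\<exists>C::real. \<exists>n0 k0 :: nat. \<forall>n\<ge>n0. \<forall>k\<ge>k0.
    real k \<le> real n powr ((real s - 1) / (real s * (real s * real t - 1)))
               / ln (real n) powr (1 / (real s - 1)) \<longrightarrow>
    (\<exists>\<G> \<subseteq> graphs_on n.
       finite \<G> \<and>
       real (card \<G>) \<le> exp (C * real k powr (- (real s - 1))
                              * real n powr (2 - 1 / real s) * ln (real k)) \<and>
       (\<forall>G\<in>\<G>. real (num_edges G) \<le> real k * real n powr (2 - 1 / real s)) \<and>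
       (\<forall>H\<in>graphs_on n. K_free s t H \<longrightarrow> (\<exists>G\<in>\<G>. subgraph H G)))"
proof -
  define p where "p = s - 1"
  have p: "1 \<le> p" "real p = real s - 1" using assms by (auto simp: p_def of_nat_diff)
  have t1: "1 \<le> t" using assms by simp
  obtain c Q :: real where cQ: "0 < c" "c < 1" "0 < Q" and
    step: "\<And>n E x \<kappa>. 1 \<le> n \<Longrightarrow> E \<subseteq> pairs_on {1..n} \<Longrightarrow>
     real (card E) = x * real n powr (2 - 1 / real s) \<Longrightarrow> 8 * real s * real t \<le> x \<Longrightarrow>
     1 \<le> \<kappa> \<Longrightarrow> \<kappa> ^ (s * t - 1) = real n powr (1 - 1 / real s) \<Longrightarrow>
     \<exists>\<C>. \<C> \<subseteq> Pow E \<and>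
        real (card \<C>) \<le> exp (Q * (real n powr (2 - 1 / real s) * ln x / min x \<kappa> ^ p)) \<and>
        (\<forall>C\<in>\<C>. real (card C) \<le> (1 - c) * real (card E)) \<and>
        (\<forall>I\<subseteq>E. K_free s t ({1..n}, I) \<longrightarrow> (\<exists>C\<in>\<C>. I \<subseteq> C))"
    by (rule graph_container_step[OF assms(1) t1, folded p_def]) (rule that)
  define \<theta> where "\<theta> = 1 / (1 - c)"
  have \<theta>: "1 < \<theta>" using cQ by (simp add: \<theta>_def)
  have ln\<theta>: "0 < ln \<theta>" using \<theta> by simp
  have st4: "2 * 2 \<le> s * t" using assms by (intro mult_le_mono) auto
  then have "1 \<le> s * t" by linarith
  then have st1: "real (s * t - 1) = real s * real t - 1" by (simp only: of_nat_diff of_nat_mult of_nat_1)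
  have st3: "3 \<le> real s * real t - 1" using st4 unfolding st1[symmetric] by simp
  define \<rho> where "\<rho> = (real s - 1) / (real s * (real s * real t - 1))"
  have \<rho>: "0 < \<rho>" using assms st3 by (simp add: \<rho>_def)
  define C1 where "C1 = (1 + ln \<theta>) / (1 - 1 / \<theta>)\<^sup>2"
  define C2 where "C2 = (1 / ln \<theta> + 1) * (2 + ln \<theta>)"
  define C3 where "C3 = 2 / \<rho> + (4 / \<rho>)\<^sup>2"
  have C2: "0 \<le> C2" using ln\<theta> by (simp add: C2_def)
  show ?thesis
  \<comment> \<open>\<open>C1\<close> pays for the geometric series and \<open>C2 * C3\<close> for
    the levels above \<open>\<kappa>\<close>. From \<open>n \<ge> 3\<close> follows
    \<open>ln n \<ge> 1\<close>, and \<open>8 * s * t\<close> is the density from which the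
    container step is available.\<close>
  proof (rule exI[of _ "Q * (C1 + C2 * C3)"], rule exI[of _ 3], rule exI[of _ "8 * s * t"],
      intro allI impI)
    fix n k :: nat
    assume n: "3 \<le> n" and k: "8 * s * t \<le> k"
      and le: "real k \<le> real n powr ((real s - 1) / (real s * (real s * real t - 1)))
               / ln (real n) powr (1 / (real s - 1))"
    define \<kappa> where "\<kappa> = real n powr \<rho>"
    define N where "N = real n powr (2 - 1 / real s)"
    have e3: "exp 1 \<le> (3::real)" using exp_le by simp
    have kst: "8 * real s * real t \<le> real k" using k by (metis of_nat_le_iff of_nat_mult of_nat_numeral)
    have n3: "exp 1 \<le> real n" "1 \<le> real n" using n e3 by auto
    have k3: "exp 1 \<le> real k" "1 \<le> real k" using k st4 e3 by auto
    have lnn: "1 \<le> ln (real n)" "1 \<le> ln (real k)"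
      using n3 k3 by (metis ln_exp ln_mono exp_gt_zero)+
    have \<kappa>1: "1 \<le> \<kappa>" unfolding \<kappa>_def using n3 \<rho> by (intro ge_one_powr_ge_zero) auto
    have \<kappa>pow: "\<kappa> ^ (s * t - 1) = real n powr (1 - 1 / real s)"
    proof -
      have "\<rho> * real (s * t - 1) = 1 - 1 / real s"
        using st3 assms unfolding st1 \<rho>_def by (simp add: field_simps)
      then show ?thesis using n3 by (simp add: \<kappa>_def powr_power mult.commute)
    qed
    have le': "real k \<le> \<kappa> / ln (real n) powr (1 / real p)" using le by (simp add: \<kappa>_def \<rho>_def p)
    \<comment> \<open>The bound on \<open>k\<close> gives \<open>k \<le> n\<close>, so
      \<open>ln k\<close> can be replaced by \<open>ln n\<close> in the levels above
      \<open>\<kappa>\<close>.\<close>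
    have "\<kappa> / ln (real n) powr (1 / real p) \<le> \<kappa> / 1"
      using lnn \<kappa>1 by (intro divide_left_mono ge_one_powr_ge_zero) auto
    moreover have "\<kappa> \<le> \<kappa> ^ (s * t - 1)" using \<kappa>1 st4 by (intro self_le_power) auto
    moreover have "real n powr (1 - 1 / real s) \<le> real n powr 1" using n3 by (intro powr_mono) auto
    ultimately have "real k \<le> real n" using le' \<kappa>pow n3 by simp
    then have lnkn: "ln (real k) \<le> ln (real n)" using k3 by simp
    have N: "real n \<le> N"
    proof -
      have "real n powr 1 \<le> N" unfolding N_def using n3 assms
        by (intro powr_mono) (auto simp: field_simps)
      then show ?thesis using n3 by simp
    qed
    then have N0: "0 < N" using n3 by linarith
    \<comment> \<open>So \<open>\<theta> ^ i\<close> is at least \<open>n\<close>; since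
      \<open>N\<close> is at least \<open>n\<close> too, the complete graph lies within the first
      \<open>i\<close> levels.\<close>
    define i where "i = nat \<lceil>ln (real n) / ln \<theta>\<rceil>"
    have "0 \<le> ln (real n) / ln \<theta>" using lnn ln\<theta> by simp
    then have i: "ln (real n) / ln \<theta> \<le> real i" "real i \<le> ln (real n) / ln \<theta> + 1"
      by (auto simp: i_def of_nat_nat)
    have i1: "ln (real n) \<le> real i * ln \<theta>" "real i * ln \<theta> \<le> ln (real n) + ln \<theta>"
      using i ln\<theta> by (auto simp: field_simps)
    \<comment> \<open>The logarithm is taken at the upper end of level \<open>j\<close> and the
      minimum at the lower end, so the cost depends on the level alone.\<close>
    define cost where "cost = (\<lambda>j. Q * (N * (ln (real k * \<theta> ^ Suc j) / min (real k * \<theta> ^ j) \<kappa> ^ p)))"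
    have k\<theta>: "real k \<le> real k * \<theta> ^ j" for j using \<theta> k3 by simp
    have ln0: "0 \<le> ln (real k * \<theta> ^ j)" for j
      by (rule ln_ge_zero, rule order_trans[OF k3(2) k\<theta>])
    have "\<exists>\<C>. \<C> \<subseteq> Pow (pairs_on {1..n}) \<and> real (card \<C>) \<le> exp (\<Sum>j<i. cost j) \<and>
        (\<forall>C\<in>\<C>. real (card C) \<le> real k * N) \<and>
        (\<forall>I\<subseteq>pairs_on {1..n}. K_free s t ({1..n}, I) \<longrightarrow> (\<exists>C\<in>\<C>. I \<subseteq> C))"
    proof (rule iterated_containers[OF _ cQ(2) \<theta>_def _ N0 _ _ order_refl])
      show "0 \<le> cost j" for j
        unfolding cost_def
        by (intro mult_nonneg_nonneg divide_nonneg_nonneg zero_le_power ln0) (use cQ N0 k3 \<kappa>1 \<theta> in auto)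
    next
      fix j E
      assume E: "E \<subseteq> pairs_on {1..n}" "real k * \<theta> ^ j * N < real (card E)"
        "real (card E) \<le> real k * \<theta> ^ Suc j * N"
      define x where "x = real (card E) / N"
      have x: "real (card E) = x * N" "real k * \<theta> ^ j \<le> x" "x \<le> real k * \<theta> ^ Suc j"
        using E N0 by (auto simp: x_def field_simps)
      have x8: "8 * real s * real t \<le> x" using x(2) k\<theta>[of j] kst by linarith
      have "n \<ge> 1" using n by simp
      from step[OF this E(1) x(1)[unfolded N_def] x8 \<kappa>1 \<kappa>pow] obtain \<C> where
        \<C>: "\<C> \<subseteq> Pow E" "real (card \<C>) \<le> exp (Q * (N * ln x / min x \<kappa> ^ p))"
        "\<forall>C\<in>\<C>. real (card C) \<le> (1 - c) * real (card E)"
        "\<forall>I\<subseteq>E. K_free s t ({1..n}, I) \<longrightarrow> (\<exists>C\<in>\<C>. I \<subseteq> C)"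
        unfolding N_def by blast
      have "0 < x" using x(2) k\<theta>[of j] k3 by linarith
      then have "ln x \<le> ln (real k * \<theta> ^ Suc j)" using x(3) by simp
      moreover have "0 < min (real k * \<theta> ^ j) \<kappa>" using k3 \<theta> \<kappa>1 by simp
      moreover have "min (real k * \<theta> ^ j) \<kappa> \<le> min x \<kappa>" using x(2) by auto
      ultimately have "ln x / min x \<kappa> ^ p \<le> ln (real k * \<theta> ^ Suc j) / min (real k * \<theta> ^ j) \<kappa> ^ p"
        using ln0[of "Suc j"] by (intro frac_le power_mono) auto
      then have "Q * (N * ln x / min x \<kappa> ^ p) \<le> cost j"
        unfolding cost_def times_divide_eq_right[symmetric] using cQ N0 by (intro mult_left_mono) auto
      then have "exp (Q * (N * ln x / min x \<kappa> ^ p)) \<le> exp (cost j)" by simp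
      then have "real (card \<C>) \<le> exp (cost j)" using \<C>(2) by linarith
      then show "\<exists>\<C>. \<C> \<subseteq> Pow E \<and> real (card \<C>) \<le> exp (cost j) \<and>
        (\<forall>C\<in>\<C>. real (card C) \<le> (1 - c) * real (card E)) \<and>
        (\<forall>I\<subseteq>E. K_free s t ({1..n}, I) \<longrightarrow> (\<exists>C\<in>\<C>. I \<subseteq> C))"
        using \<C>(1,3,4) by blast
    next
      have "card (pairs_on {1..n}) = n choose 2" by (simp add: n_subsets)
      also have "\<dots> \<le> n ^ 2" using n by (intro binomial_le_pow) auto
      finally have "real (card (pairs_on {1..n})) \<le> real n * real n"
        by (metis of_nat_le_iff of_nat_mult power2_eq_square)
      also have "\<dots> \<le> \<theta> ^ i * N"
      proof -
        have "real n = exp (ln (real n))" using n3 by simp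
        also have "\<dots> \<le> exp (real i * ln \<theta>)" using i1 by simp
        also have "\<dots> = \<theta> ^ i" using \<theta> by (simp add: exp_of_nat_mult)
        finally show ?thesis using N n3 \<theta> by (intro mult_mono) auto
      qed
      also have "\<dots> \<le> real k * \<theta> ^ i * N"
        using k3 \<theta> N0 by (intro mult_right_mono) auto
      finally show "real (card (pairs_on {1..n})) \<le> real k * \<theta> ^ i * N" .
    next
      show "finite (pairs_on {1..n})" by (rule finite_subset[of _ "Pow {1..n}"]) auto
      show "0 < real k" using k3 by linarith
    qed
    then obtain \<C> where \<C>: "\<C> \<subseteq> Pow (pairs_on {1..n})" "real (card \<C>) \<le> exp (\<Sum>j<i. cost j)"
      "\<forall>C\<in>\<C>. real (card C) \<le> real k * N"
      "\<forall>I\<subseteq>pairs_on {1..n}. K_free s t ({1..n}, I) \<longrightarrow> (\<exists>C\<in>\<C>. I \<subseteq> C)"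
      by (elim exE conjE) (rule that)
    have "real i * (ln (real k) + real i * ln \<theta>)
        \<le> ((1 / ln \<theta> + 1) * ln (real n)) * ((2 + ln \<theta>) * ln (real n))"
    proof (rule mult_mono)
      show "real i \<le> (1 / ln \<theta> + 1) * ln (real n)" using i(2) lnn by (simp add: algebra_simps)
      have "ln \<theta> * 1 \<le> ln \<theta> * ln (real n)" using lnn ln\<theta> by (intro mult_left_mono) auto
      then show "ln (real k) + real i * ln \<theta> \<le> (2 + ln \<theta>) * ln (real n)"
        using i1(2) lnkn by (simp add: algebra_simps)
    qed (use lnn ln\<theta> in auto)
    also have "\<dots> = C2 * (ln (real n))\<^sup>2" by (simp add: C2_def power2_eq_square)
    finally have "real i * (ln (real k) + real i * ln \<theta>) / \<kappa> ^ p \<le> C2 * (ln (real n))\<^sup>2 / \<kappa> ^ p"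
      using \<kappa>1 by (intro divide_right_mono) auto
    also have "\<dots> = C2 * ((ln (real n))\<^sup>2 / \<kappa> ^ p)" by simp
    also have "\<dots> \<le> C2 * (C3 * (ln (real k) / real k ^ p))"
      unfolding C3_def using log_square_absorbed[OF p(1) \<rho> n3(1) k3(1) \<kappa>_def le'] C2
      by (intro mult_left_mono)
    finally have "(\<Sum>j<i. ln (real k * \<theta> ^ Suc j) / min (real k * \<theta> ^ j) \<kappa> ^ p)
        \<le> C1 * (ln (real k) / real k ^ p) + C2 * (C3 * (ln (real k) / real k ^ p))"
      using sum_level_costs[OF \<theta> p(1) k3(1) \<kappa>1, of i] unfolding C1_def by linarith
    then have "Q * (N * (\<Sum>j<i. ln (real k * \<theta> ^ Suc j) / min (real k * \<theta> ^ j) \<kappa> ^ p))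
        \<le> Q * (N * (C1 * (ln (real k) / real k ^ p) + C2 * (C3 * (ln (real k) / real k ^ p))))"
      using cQ N0 by (intro mult_left_mono) auto
    moreover have "real k powr (- (real s - 1)) = 1 / real k ^ p"
      using k3 by (simp add: p(2)[symmetric] powr_minus_divide powr_realpow del: minus_diff_eq)
    ultimately have total: "(\<Sum>j<i. cost j)
        \<le> Q * (C1 + C2 * C3) * real k powr (- (real s - 1)) * N * ln (real k)"
      unfolding cost_def sum_distrib_left[symmetric] by (simp add: algebra_simps add_divide_distrib)
    have fin: "finite \<C>" by (rule finite_subset[OF \<C>(1)]) simp
    show "\<exists>\<G>\<subseteq>graphs_on n. finite \<G> \<and>
       real (card \<G>) \<le> exp (Q * (C1 + C2 * C3) * real k powr (- (real s - 1))
                              * real n powr (2 - 1 / real s) * ln (real k)) \<and>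
       (\<forall>G\<in>\<G>. real (num_edges G) \<le> real k * real n powr (2 - 1 / real s)) \<and>
       (\<forall>H\<in>graphs_on n. K_free s t H \<longrightarrow> (\<exists>G\<in>\<G>. subgraph H G))"
    proof (intro exI[of _ "Pair {1..n} ` \<C>"] conjI ballI impI)
      show "Pair {1..n} ` \<C> \<subseteq> graphs_on n"
      proof
        fix G assume "G \<in> Pair {1..n} ` \<C>"
        then obtain C where "G = ({1..n}, C)" "C \<subseteq> pairs_on {1..n}" using \<C>(1) by blast
        then show "G \<in> graphs_on n" by (auto simp: graphs_on_def simple_graph_def)
      qed
      show "finite (Pair {1..n} ` \<C>)" using fin by simp
      have "card (Pair {1..n} ` \<C>) \<le> card \<C>" by (rule card_image_le[OF fin])
      then show "real (card (Pair {1..n} ` \<C>)) \<le> exp (Q * (C1 + C2 * C3) *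
          real k powr (- (real s - 1)) * real n powr (2 - 1 / real s) * ln (real k))"
        using \<C>(2) total unfolding N_def by (meson exp_le_cancel_iff of_nat_le_iff order_trans)
    next
      fix G assume "G \<in> Pair {1..n} ` \<C>"
      then show "real (num_edges G) \<le> real k * real n powr (2 - 1 / real s)"
        using \<C>(3) by (auto simp: num_edges_def N_def)
    next
      fix H assume H: "H \<in> graphs_on n" "K_free s t H"
      then have E: "H = ({1..n}, edges H)" "edges H \<subseteq> pairs_on {1..n}"
        by (auto simp: graphs_on_def simple_graph_def prod_eq_iff)
      have "K_free s t ({1..n}, edges H)" using H(2) E(1) by simp
      with \<C>(4) E(2) obtain C where "C \<in> \<C>" "edges H \<subseteq> C" by blast
      then show "\<exists>G\<in>Pair {1..n} ` \<C>. subgraph H G"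
        using H(1) by (auto simp: subgraph_def graphs_on_def)
    qed
  qed
qed

end
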